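(* Let $X$ be a Banach space of analytic functions on the unit disc $\mathbb{D}$ such that $H^\infty\subseteq X\subseteq\mathcal{B}$, and such that $\mathcal{O}(\overline{\mathbb{D}})\hookrightarrow X\hookrightarrow\operatorname{Hol}(\mathbb{D})$ with both embeddings continuous. Let $\Phi=\{\varphi_t\}_{t\ge 0}$ be a nontrivial holomorphic flow in $\mathbb{D}$, let $m$ be a cocycle for $\Phi$, and let $\{W_t\}_{t\ge 0}$ be the weighted composition semigroup given by $$W_tf(z)=m_t(z)\,f(\varphi_t(z)),\qquad z\in\mathbb{D},\ t\ge 0,\ f\in X.$$ Then $\{W_t\}_{t\ge 0}$ is not a strongly continuous semigroup on $X$.
   Context: $\mathbb{D}$ is the open unit disc in $\mathbb{C}$. $H^\infty$ is the algebra of bounded analytic functions on $\mathbb{D}$. $\mathcal{B}$ is the Bloch space of analytic functions $f$ on $\mathbb{D}$ with $\|f\|_{\mathcal{B}}=|f(0)|+\sup_{z\in\mathbb{D}}|f'(z)|(1-|z|^2)<\infty$. The inclusions $H^\infty\subseteq X\subseteq\mathcal{B}$ are inclusions of sets. $\operatorname{Hol}(\mathbb{D})$ is the space of all analytic functions on $\mathbb{D}$ with the topology of uniform convergence on compact subsets. $\mathcal{O}(\overline{\mathbb{D}})$ is the space of functions holomorphic on a neighborhood of the closed disc $\overline{\mathbb{D}}$, with its usual (inductive limit) topology. A strongly continuous semigroup ($C_0$-semigroup) on $X$ is a family $\{T_t\}_{t\ge 0}$ of bounded linear operators on $X$ with $T_0=I$, $T_tT_s=T_{t+s}$ for all $t,s\ge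 0$, and $\lim_{t\to 0^+}T_tf=f$ in the norm of $X$ for every $f\in X$. A holomorphic flow in $\mathbb{D}$ is a family $\Phi=\{\varphi_t\}_{t\ge 0}$ of analytic self-maps of $\mathbb{D}$ such that (1) $\varphi_0(z)=z$ for all $z\in\mathbb{D}$; (2) $\varphi_{t+s}(z)=\varphi_t\circ\varphi_s(z)$ for all $t,s\ge 0$, $z\in\mathbb{D}$; (3) $\lim_{t\to s}\varphi_t(z)=\varphi_s(z)$ for all $s\ge 0$, $z\in\mathbb{D}$. It is trivial if $\varphi_t(z)=z$ for all $t\ge 0$ and $z\in\mathbb{D}$, and nontrivial otherwise. A (multiplicative) cocycle for $\Phi$ is a continuous function $m:[0,+\infty)\times\mathbb{D}\to\mathbb{C}$, written $m_t(z)=m(t,z)$, such that (1) $m_t$ is analytic on $\mathbb{D}$ for all $t\ge 0$; (2) $m_0(z)=1$ for all $z\in\mathbb{D}$; (3) $m_{t+s}(z)=m_s(z)\,m_t(\varphi_s(z))$ for all $t,s\ge 0$, $z\in\mathbb{D}$. *)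

theory Defs
  imports "HOL-Complex_Analysis.Complex_Analysis"
begin

abbreviation unit_disc :: "complex set"
  where "unit_disc \<equiv> ball 0 1"

text \<open>
  A function on \<open>U\<close> is represented by its extension by zero to the whole plane, so that equality of
  elements of a function space is equality of functions on \<open>U\<close>.
\<close>

definition zero_ext :: "complex set \<Rightarrow> (complex \<Rightarrow> complex) \<Rightarrow> complex \<Rightarrow> complex"
  where "zero_ext U f = (\<lambda>z. if z \<in> U then f z else 0)"

definition Hol :: "complex set \<Rightarrow> (complex \<Rightarrow> complex) set"
  where "Hol U = {f. f holomorphic_on U \<and> (\<forall>z. z \<notin> U \<longrightarrow> f z = 0)}"

definition H_infinity :: "(complex \<Rightarrow> complex) set"
  where "H_infinity = {f \<in> Hol unit_disc. bounded (f ` unit_disc)}"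

definition bloch_norm :: "(complex \<Rightarrow> complex) \<Rightarrow> ennreal"
  where "bloch_norm f =
    ennreal (cmod (f 0)) + (SUP z\<in>unit_disc. ennreal (cmod (deriv f z) * (1 - (cmod z)\<^sup>2)))"

definition Bloch :: "(complex \<Rightarrow> complex) set"
  where "Bloch = {f \<in> Hol unit_disc. bloch_norm f < \<infinity>}"


subsection \<open>Uniform convergence on compact subsets\<close>

definition Hol_topology :: "complex set \<Rightarrow> (complex \<Rightarrow> complex) topology"
  where "Hol_topology U = topology (\<lambda>W. W \<subseteq> Hol U \<and>
    (\<forall>f\<in>W. \<exists>K e. compact K \<and> K \<subseteq> U \<and> e > 0 \<and>
      {g \<in> Hol U. \<forall>z\<in>K. dist (g z) (f z) < e} \<subseteq> W))"

lemma openin_Hol_topology: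
  "openin (Hol_topology U) W \<longleftrightarrow> W \<subseteq> Hol U \<and>
    (\<forall>f\<in>W. \<exists>K e. compact K \<and> K \<subseteq> U \<and> e > 0 \<and>
      {g \<in> Hol U. \<forall>z\<in>K. dist (g z) (f z) < e} \<subseteq> W)"
proof -
  let ?P = "\<lambda>W. W \<subseteq> Hol U \<and> (\<forall>f\<in>W. \<exists>K e. compact K \<and> K \<subseteq> U \<and> e > 0 \<and>
      {g \<in> Hol U. \<forall>z\<in>K. dist (g z) (f z) < e} \<subseteq> W)"
  have "istopology ?P"
    unfolding istopology_def
  proof (intro conjI allI impI)
    fix S T assume S: "?P S" and T: "?P T"
    show "S \<inter> T \<subseteq> Hol U" using S by blast
    show "\<forall>f\<in>S \<inter> T. \<exists>K e. compact K \<and> K \<subseteq> U \<and> e > 0 \<and>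
      {g \<in> Hol U. \<forall>z\<in>K. dist (g z) (f z) < e} \<subseteq> S \<inter> T"
    proof
      fix f assume "f \<in> S \<inter> T"
      then obtain K e L d where "compact K" "K \<subseteq> U" "e > 0"
        "{g \<in> Hol U. \<forall>z\<in>K. dist (g z) (f z) < e} \<subseteq> S"
        "compact L" "L \<subseteq> U" "d > 0" "{g \<in> Hol U. \<forall>z\<in>L. dist (g z) (f z) < d} \<subseteq> T"
        using S T by (meson IntD1 IntD2)
      then show "\<exists>K e. compact K \<and> K \<subseteq> U \<and> e > 0 \<and>
          {g \<in> Hol U. \<forall>z\<in>K. dist (g z) (f z) < e} \<subseteq> S \<inter> T"
        by (intro exI[of _ "K \<union> L"] exI[of _ "min e d"]) (auto simp: compact_Un)
    qed
  next
    fix \<K> assume K: "\<forall>W\<in>\<K>. ?P W"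
    show "\<Union>\<K> \<subseteq> Hol U" using K by blast
    show "\<forall>f\<in>\<Union>\<K>. \<exists>K e. compact K \<and> K \<subseteq> U \<and> e > 0 \<and>
      {g \<in> Hol U. \<forall>z\<in>K. dist (g z) (f z) < e} \<subseteq> \<Union>\<K>"
    proof
      fix f assume "f \<in> \<Union>\<K>"
      then obtain W where W: "W \<in> \<K>" "f \<in> W" by blast
      then obtain K e where "compact K" "K \<subseteq> U" "e > 0"
        "{g \<in> Hol U. \<forall>z\<in>K. dist (g z) (f z) < e} \<subseteq> W"
        using K by meson
      with W show "\<exists>K e. compact K \<and> K \<subseteq> U \<and> e > 0 \<and>
          {g \<in> Hol U. \<forall>z\<in>K. dist (g z) (f z) < e} \<subseteq> \<Union>\<K>"
        by blast
    qed
  qed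
  then show ?thesis
    unfolding Hol_topology_def by (simp add: topology_inverse')
qed

lemma openin_Hol_topology_Hol: "openin (Hol_topology U) (Hol U)"
  unfolding openin_Hol_topology by (auto intro!: exI[of _ "{}"] exI[of _ "1::real"])

lemma topspace_Hol_topology: "topspace (Hol_topology U) = Hol U"
  proof
  have "openin (Hol_topology U) (topspace (Hol_topology U))" by (rule openin_topspace)
  then show "topspace (Hol_topology U) \<subseteq> Hol U"
    unfolding openin_Hol_topology by (rule conjunct1)
  show "Hol U \<subseteq> topspace (Hol_topology U)"
    by (rule openin_subset[OF openin_Hol_topology_Hol])
qed


subsection \<open>Functions holomorphic on a neighbourhood of the closed disc\<close>

text \<open>
  By the identity theorem the germ of a holomorphic function along the closed disc is determined by
  its restriction to the open disc, and germs are represented by these restrictions. The topology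
  is the locally convex inductive limit of the spaces \<open>Hol U\<close>, where \<open>U\<close> ranges over the open
  neighbourhoods of the closed disc: a base of neighbourhoods of zero consists of the absolutely
  convex sets whose preimage in each \<open>Hol U\<close> is a neighbourhood of zero.
\<close>

definition closed_disc_nbhd :: "complex set \<Rightarrow> bool"
  where "closed_disc_nbhd U \<longleftrightarrow> open U \<and> cball 0 1 \<subseteq> U"

definition Hol_closed_disc :: "(complex \<Rightarrow> complex) set"
  where "Hol_closed_disc = {zero_ext unit_disc g | g U. closed_disc_nbhd U \<and> g \<in> Hol U}"

definition absolutely_convex :: "(complex \<Rightarrow> complex) set \<Rightarrow> bool"
  where "absolutely_convex V \<longleftrightarrow>
    (\<forall>u\<in>V. \<forall>v\<in>V. \<forall>a b. cmod a + cmod b \<le> 1 \<longrightarrow> (\<lambda>z. a * u z + b * v z) \<in> V)"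

definition inductive_limit_nbhd :: "(complex \<Rightarrow> complex) set \<Rightarrow> bool"
  where "inductive_limit_nbhd V \<longleftrightarrow> V \<subseteq> Hol_closed_disc \<and> absolutely_convex V \<and>
    (\<forall>U. closed_disc_nbhd U \<longrightarrow>
      (\<exists>W. openin (Hol_topology U) W \<and> (\<lambda>z. 0) \<in> W \<and> zero_ext unit_disc ` W \<subseteq> V))"

definition Hol_closed_disc_topology :: "(complex \<Rightarrow> complex) topology"
  where "Hol_closed_disc_topology = topology (\<lambda>W. W \<subseteq> Hol_closed_disc \<and>
    (\<forall>f\<in>W. \<exists>V. inductive_limit_nbhd V \<and> (\<forall>v\<in>V. (\<lambda>z. f z + v z) \<in> W)))"

lemma inductive_limit_nbhd_Int:
  assumes "inductive_limit_nbhd V" "inductive_limit_nbhd V'"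
  shows "inductive_limit_nbhd (V \<inter> V')"
  unfolding inductive_limit_nbhd_def
proof (intro conjI allI impI)
  show "V \<inter> V' \<subseteq> Hol_closed_disc"
    using assms by (auto simp: inductive_limit_nbhd_def)
  show "absolutely_convex (V \<inter> V')"
    using assms by (auto simp: inductive_limit_nbhd_def absolutely_convex_def)
  fix U assume "closed_disc_nbhd U"
  then obtain W W' where
    "openin (Hol_topology U) W" "(\<lambda>z. 0) \<in> W" "zero_ext unit_disc ` W \<subseteq> V"
    "openin (Hol_topology U) W'" "(\<lambda>z. 0) \<in> W'" "zero_ext unit_disc ` W' \<subseteq> V'"
    using assms unfolding inductive_limit_nbhd_def by meson
  then show "\<exists>W. openin (Hol_topology U) W \<and> (\<lambda>z. 0) \<in> W \<and> zero_ext unit_disc ` W \<subseteq> V \<inter> V'"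
    by (intro exI[of _ "W \<inter> W'"]) auto
qed

lemma openin_Hol_closed_disc_topology:
  "openin Hol_closed_disc_topology W \<longleftrightarrow> W \<subseteq> Hol_closed_disc \<and>
    (\<forall>f\<in>W. \<exists>V. inductive_limit_nbhd V \<and> (\<forall>v\<in>V. (\<lambda>z. f z + v z) \<in> W))"
proof -
  let ?P = "\<lambda>W. W \<subseteq> Hol_closed_disc \<and>
    (\<forall>f\<in>W. \<exists>V. inductive_limit_nbhd V \<and> (\<forall>v\<in>V. (\<lambda>z. f z + v z) \<in> W))"
  have "istopology ?P"
    unfolding istopology_def
  proof (intro conjI allI impI)
    fix S T assume S: "?P S" and T: "?P T"
    show "S \<inter> T \<subseteq> Hol_closed_disc" using S by blast
    show "\<forall>f\<in>S \<inter> T. \<exists>V. inductive_limit_nbhd V \<and> (\<forall>v\<in>V. (\<lambda>z. f z + v z) \<in> S \<inter> T)"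
    proof
      fix f assume f: "f \<in> S \<inter> T"
      from S f obtain V where V: "inductive_limit_nbhd V" "\<forall>v\<in>V. (\<lambda>z. f z + v z) \<in> S"
        by blast
      from T f obtain V' where V': "inductive_limit_nbhd V'" "\<forall>v\<in>V'. (\<lambda>z. f z + v z) \<in> T"
        by blast
      from V V' show "\<exists>V. inductive_limit_nbhd V \<and> (\<forall>v\<in>V. (\<lambda>z. f z + v z) \<in> S \<inter> T)"
        by (intro exI[of _ "V \<inter> V'"]) (auto simp: inductive_limit_nbhd_Int)
    qed
  next
    fix \<K> assume K: "\<forall>W\<in>\<K>. ?P W"
    show "\<Union>\<K> \<subseteq> Hol_closed_disc" using K by blast
    show "\<forall>f\<in>\<Union>\<K>. \<exists>V. inductive_limit_nbhd V \<and> (\<forall>v\<in>V. (\<lambda>z. f z + v z) \<in> \<Union>\<K>)"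
    proof
      fix f assume "f \<in> \<Union>\<K>"
      then obtain W where W: "W \<in> \<K>" "f \<in> W" by blast
      with K obtain V where "inductive_limit_nbhd V" "\<forall>v\<in>V. (\<lambda>z. f z + v z) \<in> W"
        by blast
      with W show "\<exists>V. inductive_limit_nbhd V \<and> (\<forall>v\<in>V. (\<lambda>z. f z + v z) \<in> \<Union>\<K>)"
        by blast
    qed
  qed
  then show ?thesis
    unfolding Hol_closed_disc_topology_def by (simp add: topology_inverse')
qed

lemma Hol_closed_disc_lincomb:
  assumes "f \<in> Hol_closed_disc" "g \<in> Hol_closed_disc"
  shows "(\<lambda>z. a * f z + b * g z) \<in> Hol_closed_disc"
proof -
  from assms obtain f' g' U V where *:
    "f = zero_ext unit_disc f'" "closed_disc_nbhd U" "f' \<in> Hol U"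
    "g = zero_ext unit_disc g'" "closed_disc_nbhd V" "g' \<in> Hol V"
    unfolding Hol_closed_disc_def by blast
  let ?h = "zero_ext (U \<inter> V) (\<lambda>z. a * f' z + b * g' z)"
  have nb: "closed_disc_nbhd (U \<inter> V)"
    using * by (auto simp: closed_disc_nbhd_def)
  have "(\<lambda>z. a * f' z + b * g' z) holomorphic_on U \<inter> V"
    using * by (auto simp: Hol_def intro!: holomorphic_intros intro: holomorphic_on_subset)
  then have "?h holomorphic_on U \<inter> V"
    by (rule holomorphic_transform) (auto simp: zero_ext_def)
  then have h: "?h \<in> Hol (U \<inter> V)"
    by (auto simp: Hol_def zero_ext_def)
  have sub: "unit_disc \<subseteq> U \<inter> V"
    using nb by (auto simp: closed_disc_nbhd_def subset_iff)
  have "(\<lambda>z. a * f z + b * g z) = zero_ext unit_disc ?h"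
    using * sub by (auto simp: zero_ext_def fun_eq_iff)
  with nb h show ?thesis
    unfolding Hol_closed_disc_def by blast
qed

lemma topspace_Hol_closed_disc_topology:
  "topspace Hol_closed_disc_topology = Hol_closed_disc"
proof -
  have "inductive_limit_nbhd Hol_closed_disc"
    unfolding inductive_limit_nbhd_def
  proof (intro conjI allI impI)
    show "absolutely_convex Hol_closed_disc"
      by (simp add: absolutely_convex_def Hol_closed_disc_lincomb)
    fix U assume "closed_disc_nbhd U"
    moreover have "(\<lambda>z. 0) \<in> Hol U" by (simp add: Hol_def)
    ultimately show "\<exists>W. openin (Hol_topology U) W \<and> (\<lambda>z. 0) \<in> W \<and>
        zero_ext unit_disc ` W \<subseteq> Hol_closed_disc"
      by (intro exI[of _ "Hol U"]) (auto simp: openin_Hol_topology_Hol Hol_closed_disc_def)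
  qed simp
  then have "openin Hol_closed_disc_topology Hol_closed_disc"
    unfolding openin_Hol_closed_disc_topology
    using Hol_closed_disc_lincomb[where a = 1 and b = 1] by auto
  then have "Hol_closed_disc \<subseteq> topspace Hol_closed_disc_topology"
    by (rule openin_subset)
  moreover have "topspace Hol_closed_disc_topology \<subseteq> Hol_closed_disc"
    using openin_topspace[of Hol_closed_disc_topology]
    unfolding openin_Hol_closed_disc_topology by (rule conjunct1)
  ultimately show ?thesis by (rule subset_antisym[rotated])
qed


subsection \<open>Banach spaces of analytic functions on the disc\<close>

text \<open>The case distinction only makes this a total symmetric function, as \<open>Metric_space\<close> requires.\<close>

definition norm_dist ::
    "(complex \<Rightarrow> complex) set \<Rightarrow> ((complex \<Rightarrow> complex) \<Rightarrow> real) \<Rightarrow>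
      (complex \<Rightarrow> complex) \<Rightarrow> (complex \<Rightarrow> complex) \<Rightarrow> real"
  where "norm_dist X N f g = (if f \<in> X \<and> g \<in> X then N (\<lambda>z. f z - g z) else 0)"

definition norm_topology ::
    "(complex \<Rightarrow> complex) set \<Rightarrow> ((complex \<Rightarrow> complex) \<Rightarrow> real) \<Rightarrow> (complex \<Rightarrow> complex) topology"
  where "norm_topology X N = Metric_space.mtopology X (norm_dist X N)"

locale normed_analytic_space =
  fixes X :: "(complex \<Rightarrow> complex) set" and N :: "(complex \<Rightarrow> complex) \<Rightarrow> real"
  assumes analytic: "X \<subseteq> Hol unit_disc"
    and zero: "(\<lambda>z. 0) \<in> X"
    and add: "f \<in> X \<Longrightarrow> g \<in> X \<Longrightarrow> (\<lambda>z. f z + g z) \<in> X"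
    and scale: "f \<in> X \<Longrightarrow> (\<lambda>z. c * f z) \<in> X"
    and norm_nonneg: "f \<in> X \<Longrightarrow> 0 \<le> N f"
    and norm_eq_0: "f \<in> X \<Longrightarrow> N f = 0 \<longleftrightarrow> f = (\<lambda>z. 0)"
    and norm_scale: "f \<in> X \<Longrightarrow> N (\<lambda>z. c * f z) = cmod c * N f"
    and norm_triangle: "f \<in> X \<Longrightarrow> g \<in> X \<Longrightarrow> N (\<lambda>z. f z + g z) \<le> N f + N g"
begin

lemma diff: "f \<in> X \<Longrightarrow> g \<in> X \<Longrightarrow> (\<lambda>z. f z - g z) \<in> X"
  using add[of f "\<lambda>z. - 1 * g z"] scale[of g "- 1"] by simp

sublocale Metric_space X "norm_dist X N"
proof
  fix f g show "0 \<le> norm_dist X N f g"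
    by (simp add: norm_dist_def diff norm_nonneg)
  show "norm_dist X N f g = norm_dist X N g f"
    using norm_scale[OF diff[of f g], of "- 1"] by (simp add: norm_dist_def)
next
  fix f g assume "f \<in> X" "g \<in> X"
  then show "norm_dist X N f g = 0 \<longleftrightarrow> f = g"
    by (simp add: norm_dist_def diff norm_eq_0 fun_eq_iff)
next
  fix f g h assume "f \<in> X" "g \<in> X" "h \<in> X"
  then show "norm_dist X N f h \<le> norm_dist X N f g + norm_dist X N g h"
    using norm_triangle[OF diff[of f g] diff[of g h]] by (simp add: norm_dist_def)
qed

end

locale banach_analytic_space = normed_analytic_space +
  assumes complete: mcomplete


subsection \<open>Semigroups, flows and cocycles\<close>

definition bounded_linear_operator_on ::
    "(complex \<Rightarrow> complex) set \<Rightarrow> ((complex \<Rightarrow> complex) \<Rightarrow> real) \<Rightarrow>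
      ((complex \<Rightarrow> complex) \<Rightarrow> complex \<Rightarrow> complex) \<Rightarrow> bool"
  where "bounded_linear_operator_on X N A \<longleftrightarrow>
    A ` X \<subseteq> X \<and>
    (\<forall>f\<in>X. \<forall>g\<in>X. A (\<lambda>z. f z + g z) = (\<lambda>z. A f z + A g z)) \<and>
    (\<forall>f\<in>X. \<forall>c. A (\<lambda>z. c * f z) = (\<lambda>z. c * A f z)) \<and>
    (\<exists>C. \<forall>f\<in>X. N (A f) \<le> C * N f)"

definition strongly_continuous_semigroup ::
    "(complex \<Rightarrow> complex) set \<Rightarrow> ((complex \<Rightarrow> complex) \<Rightarrow> real) \<Rightarrow>
      (real \<Rightarrow> (complex \<Rightarrow> complex) \<Rightarrow> complex \<Rightarrow> complex) \<Rightarrow> bool"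
  where "strongly_continuous_semigroup X N T \<longleftrightarrow>
    (\<forall>t\<ge>0. bounded_linear_operator_on X N (T t)) \<and>
    (\<forall>f\<in>X. T 0 f = f) \<and>
    (\<forall>t\<ge>0. \<forall>s\<ge>0. \<forall>f\<in>X. T t (T s f) = T (t + s) f) \<and>
    (\<forall>f\<in>X. ((\<lambda>t. N (\<lambda>z. T t f z - f z)) \<longlongrightarrow> 0) (at_right 0))"

definition holomorphic_flow :: "(real \<Rightarrow> complex \<Rightarrow> complex) \<Rightarrow> bool"
  where "holomorphic_flow \<phi> \<longleftrightarrow>
    (\<forall>t\<ge>0. \<phi> t holomorphic_on unit_disc \<and> \<phi> t ` unit_disc \<subseteq> unit_disc) \<and>
    (\<forall>z\<in>unit_disc. \<phi> 0 z = z) \<and>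
    (\<forall>t\<ge>0. \<forall>s\<ge>0. \<forall>z\<in>unit_disc. \<phi> (t + s) z = \<phi> t (\<phi> s z)) \<and>
    (\<forall>s\<ge>0. \<forall>z\<in>unit_disc. ((\<lambda>t. \<phi> t z) \<longlongrightarrow> \<phi> s z) (at s within {0..}))"

definition trivial_flow :: "(real \<Rightarrow> complex \<Rightarrow> complex) \<Rightarrow> bool"
  where "trivial_flow \<phi> \<longleftrightarrow> (\<forall>t\<ge>0. \<forall>z\<in>unit_disc. \<phi> t z = z)"

definition cocycle :: "(real \<Rightarrow> complex \<Rightarrow> complex) \<Rightarrow> (real \<Rightarrow> complex \<Rightarrow> complex) \<Rightarrow> bool"
  where "cocycle \<phi> m \<longleftrightarrow>
    continuous_on ({0..} \<times> unit_disc) (\<lambda>(t, z). m t z) \<and>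
    (\<forall>t\<ge>0. m t holomorphic_on unit_disc) \<and>
    (\<forall>z\<in>unit_disc. m 0 z = 1) \<and>
    (\<forall>t\<ge>0. \<forall>s\<ge>0. \<forall>z\<in>unit_disc. m (t + s) z = m s z * m t (\<phi> s z))"

definition weighted_composition ::
    "(real \<Rightarrow> complex \<Rightarrow> complex) \<Rightarrow> (real \<Rightarrow> complex \<Rightarrow> complex) \<Rightarrow>
      real \<Rightarrow> (complex \<Rightarrow> complex) \<Rightarrow> complex \<Rightarrow> complex"
  where "weighted_composition m \<phi> t f = zero_ext unit_disc (\<lambda>z. m t z * f (\<phi> t z))"

end

theory Submission imports Defs begin

text \<open>
  The Bloch seminorm is sensitive to hyperbolic displacement, and a nontrivial flow displaces some
  points by a definite hyperbolic distance at arbitrarily small times. Write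
  \<open>\<rho>(z, w) = \<bar>Moebius_function 0 w z\<bar>\<close> for the pseudohyperbolic distance. If \<open>\<rho>(z, \<phi>(z)) \<le> 1/2\<close> for
  all \<open>z\<close> near the unit circle, then \<open>\<bar>\<phi>(z) - z\<bar> \<le> 1 - \<bar>z\<bar>\<^sup>2\<close> there, so \<open>\<phi>(z) - z\<close> tends to zero at the
  boundary and \<open>\<phi>\<close> is the identity by the maximum principle. A nontrivial flow has \<open>\<phi> t \<noteq> id\<close> for
  arbitrarily small \<open>t\<close>. Hence, by compactness of the circle, there are a boundary point \<open>\<zeta>\<close> and
  sequences \<open>t n\<close> tending to zero and \<open>z n\<close> tending to \<open>\<zeta>\<close> with \<open>\<rho>(z n, w n) > 1/2\<close>, where
  \<open>w n = \<phi> (t n) (z n)\<close> (\<open>displaced_boundary_point\<close>).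

  For such a pair \<open>z, w\<close> let \<open>f\<close> be the product of the squared Blaschke factor of \<open>w\<close>, the Blaschke
  factor of \<open>z\<close>, and a function that has size comparable to one at distance \<open>\<epsilon> = \<bar>\<zeta> - z\<bar>\<close> from \<open>\<zeta>\<close> and
  decays both far from \<open>\<zeta>\<close> and close to \<open>\<zeta>\<close>. The double zero at \<open>w\<close> makes the derivative of
  \<open>m t \<cdot> (f \<circ> \<phi> t)\<close> vanish at \<open>z\<close>, whatever the weight, whereas \<open>\<bar>f'(z)\<bar> (1 - \<bar>z\<bar>\<^sup>2) \<ge> 1/16\<close>. So \<open>W t f - f\<close>
  has Bloch seminorm at least \<open>1/16\<close> (\<open>defect_hump\<close>).

  These functions are superposed by a gliding hump argument. If the scales \<open>\<epsilon>\<close> at least halve at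
  each step, the sum \<open>G\<close> of the humps is bounded, hence lies in \<open>X\<close> (\<open>lacunary_sum\<close>). Under strong
  continuity the earlier humps contribute little at time \<open>t n\<close> if \<open>t n\<close> is chosen small, and the
  later ones contribute little at \<open>z n\<close> if they are concentrated close enough to \<open>\<zeta>\<close>
  (\<open>defect_small_if_dominated\<close>). So \<open>W (t n) G - G\<close> has Bloch seminorm at least \<open>1/32\<close> for every \<open>n\<close>.
  Since the inclusion of \<open>X\<close> in the Bloch space is bounded, by the Baire category theorem
  (\<open>Bloch_inclusion_bounded\<close>), this contradicts strong continuity at \<open>G\<close>.
\<close>

section \<open>Hyperbolic displacement of a nontrivial flow\<close>

text \<open>
  With \<open>\<rho> \<le> 1/2\<close> one has \<open>\<bar>z - w\<bar> \<le> \<bar>1 - cnj w z\<bar> / 2\<close>, and \<open>1 - cnj w z\<close> differs from \<open>1 - \<bar>z\<bar>\<^sup>2\<close> by at most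
  \<open>\<bar>z - w\<bar>\<close>; half of that difference is absorbed on the left.
\<close>

lemma Moebius_function_gap:
  assumes z: "z \<in> unit_disc" and w: "w \<in> unit_disc"
    and le: "cmod (Moebius_function 0 w z) \<le> 1 / 2"
  shows "cmod (w - z) \<le> 1 - (cmod z)\<^sup>2"
proof -
  have "cmod (cnj w * z) < 1"
    using z w mult_strict_mono'[of "cmod w" 1 "cmod z" 1] by (simp add: norm_mult)
  then have nz: "1 - cnj w * z \<noteq> 0" by auto
  have eq: "1 - cnj w * z = of_real (1 - (cmod z)\<^sup>2) + cnj (z - w) * z"
    by (simp add: algebra_simps complex_norm_square del: of_real_power)
  have "cmod (1 - cnj w * z) \<le> (1 - (cmod z)\<^sup>2) + cmod (z - w) * 1"
    unfolding eq
  proof (rule norm_triangle_le, rule add_mono)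
    show "cmod (complex_of_real (1 - (cmod z)\<^sup>2)) \<le> 1 - (cmod z)\<^sup>2"
      using z abs_square_less_1[of "cmod z"] by (simp only: norm_of_real) simp
    show "cmod (cnj (z - w) * z) \<le> cmod (z - w) * 1"
      unfolding norm_mult complex_mod_cnj using z by (intro mult_left_mono) auto
  qed
  moreover have "cmod (z - w) \<le> cmod (1 - cnj w * z) / 2"
    using le nz by (simp add: Moebius_function_simple norm_divide field_simps)
  ultimately show ?thesis by (simp add: norm_minus_commute)
qed

text \<open>
  On the circle of radius \<open>s\<close> the function \<open>f(u) - u\<close> is at most \<open>1 - s\<^sup>2\<close>, and by the maximum principle
  the same bound holds inside; let \<open>s\<close> tend to one.
\<close>

lemma identity_if_boundary_gap:
  assumes hol: "f holomorphic_on unit_disc" and "r < 1"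
    and gap: "\<And>z. z \<in> unit_disc \<Longrightarrow> r < cmod z \<Longrightarrow> cmod (f z - z) \<le> 1 - (cmod z)\<^sup>2"
    and z: "z \<in> unit_disc"
  shows "f z = z"
proof -
  have le: "cmod (f z - z) \<le> 1 - s\<^sup>2" if s: "max r (cmod z) < s" "s < 1" for s
  proof (rule maximum_modulus_frontier[where f = "\<lambda>u. f u - u" and S = "ball 0 s"])
    have s0: "0 < s" using s norm_ge_zero[of z] by linarith
    have sub: "cball 0 s \<subseteq> unit_disc" using s by auto
    show "(\<lambda>u. f u - u) holomorphic_on interior (ball 0 s)"
      using s by (auto intro!: holomorphic_intros holomorphic_on_subset[OF hol])
    have "(\<lambda>u. f u - u) holomorphic_on cball 0 s"
      by (intro holomorphic_intros holomorphic_on_subset[OF hol sub])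
    then show "continuous_on (closure (ball 0 s)) (\<lambda>u. f u - u)"
      using s0 by (simp add: holomorphic_on_imp_continuous_on)
    show "cmod (f u - u) \<le> 1 - s\<^sup>2" if "u \<in> frontier (ball 0 s)" for u
      using that s0 s gap[of u] by auto
  qed (use s in auto)
  have "((\<lambda>s. 1 - s\<^sup>2) \<longlongrightarrow> 1 - 1\<^sup>2) (at_left (1::real))"
    by (intro tendsto_intros)
  moreover have "eventually (\<lambda>s. cmod (f z - z) \<le> 1 - s\<^sup>2) (at_left (1::real))"
    using le eventually_at_left_real[of "max r (cmod z)" 1] assms(2) z
    by (auto elim!: eventually_mono)
  ultimately have "cmod (f z - z) \<le> 1 - 1\<^sup>2"
    by (rule tendsto_lowerbound) simp
  then show ?thesis by simp
qed

text \<open>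
  If \<open>\<phi> s\<close> is the identity for all small \<open>s\<close>, then so is \<open>\<phi> t\<close>, which is an iterate of \<open>\<phi> (t / n)\<close>.
\<close>

lemma nontrivial_flow_moves_at_small_times:
  assumes flow: "holomorphic_flow \<phi>" and nontriv: "\<not> trivial_flow \<phi>" and "\<eta> > 0"
  shows "\<exists>t. 0 < t \<and> t < \<eta> \<and> (\<exists>z\<in>unit_disc. \<phi> t z \<noteq> z)"
proof (rule ccontr)
  assume "\<not> ?thesis"
  then have id: "\<phi> t z = z" if "0 < t" "t < \<eta>" "z \<in> unit_disc" for t z
    using that by blast
  have "\<phi> t z = z" if t: "t \<ge> 0" and z: "z \<in> unit_disc" for t z
  proof (cases "t = 0")
    case True then show ?thesis using flow z by (simp add: holomorphic_flow_def)
  next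
    case False
    then have "t > 0" using t by simp
    obtain n :: nat where n: "t / \<eta> < real n" using reals_Archimedean2 by blast
    moreover have "0 < t / \<eta>" using \<open>t > 0\<close> \<open>\<eta> > 0\<close> by simp
    ultimately have n0: "real n > 0" by linarith
    define s where "s = t / real n"
    have s: "0 < s" "s < \<eta>" using n n0 \<open>t > 0\<close> \<open>\<eta> > 0\<close> by (auto simp: s_def field_simps)
    have "\<phi> (real k * s) z = z" for k
    proof (induction k)
      case 0 then show ?case using flow z by (simp add: holomorphic_flow_def)
    next
      case (Suc k)
      have "\<phi> (s + real k * s) z = \<phi> s (\<phi> (real k * s) z)"
        using flow z s unfolding holomorphic_flow_def by simp
      then show ?case using Suc id[OF s z] by (simp add: algebra_simps)
    qed
    from this[of n] show ?thesis using n0 by (simp add: s_def)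
  qed
  then show False using nontriv by (simp add: trivial_flow_def)
qed

text \<open>
  At a small time \<open>t\<close> with \<open>\<phi> t \<noteq> id\<close> the displacement cannot stay below \<open>1/2\<close> on any annulus at the
  circle. Points near the circle that violate this bound at times tending to zero have a limit
  point \<open>\<zeta>\<close>.
\<close>

lemma displaced_boundary_point:
  assumes flow: "holomorphic_flow \<phi>" and nontriv: "\<not> trivial_flow \<phi>"
  obtains \<zeta> where "cmod \<zeta> = 1"
    and "\<And>\<eta>. \<eta> > 0 \<Longrightarrow> \<exists>t z. 0 < t \<and> t < \<eta> \<and> z \<in> unit_disc \<and> cmod (\<zeta> - z) < \<eta> \<and>
           1 / 2 < cmod (Moebius_function 0 (\<phi> t z) z)"
proof -
  have "\<exists>t z. 0 < t \<and> t < \<eta> \<and> z \<in> unit_disc \<and> 1 - \<eta> < cmod z \<and>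
           1 / 2 < cmod (Moebius_function 0 (\<phi> t z) z)" if "\<eta> > 0" for \<eta> :: real
  proof -
    obtain t where t: "0 < t" "t < \<eta>" "\<exists>z\<in>unit_disc. \<phi> t z \<noteq> z"
      using nontrivial_flow_moves_at_small_times[OF flow nontriv \<open>\<eta> > 0\<close>] by blast
    have hol: "\<phi> t holomorphic_on unit_disc" and self: "\<And>z. z \<in> unit_disc \<Longrightarrow> \<phi> t z \<in> unit_disc"
      using flow t less_imp_le[OF t(1)] unfolding holomorphic_flow_def by blast+
    have "1 - \<eta> < 1" using \<open>\<eta> > 0\<close> by simp
    then obtain z where z: "z \<in> unit_disc" "1 - \<eta> < cmod z"
        "\<not> cmod (\<phi> t z - z) \<le> 1 - (cmod z)\<^sup>2"
      using identity_if_boundary_gap[OF hol] t(3) by blast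
    then have "1 / 2 < cmod (Moebius_function 0 (\<phi> t z) z)"
      using Moebius_function_gap[OF z(1) self[OF z(1)]] by linarith
    then show ?thesis using t z by blast
  qed
  then have "\<forall>n. \<exists>t z. 0 < t \<and> t < inverse (real (Suc n)) \<and> z \<in> unit_disc \<and>
      1 - inverse (real (Suc n)) < cmod z \<and> 1 / 2 < cmod (Moebius_function 0 (\<phi> t z) z)"
    by simp
  then obtain t z where tz: "\<And>n. 0 < t n" "\<And>n. t n < inverse (real (Suc n))"
      "\<And>n. z n \<in> unit_disc" "\<And>n. 1 - inverse (real (Suc n)) < cmod (z n)"
      "\<And>n. 1 / 2 < cmod (Moebius_function 0 (\<phi> (t n) (z n)) (z n))"
    by metis
  have "z n \<in> cball 0 1" for n using tz(3)[of n] by simp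
  then obtain \<zeta> \<sigma> where \<sigma>: "strict_mono (\<sigma> :: nat \<Rightarrow> nat)" and lim: "(z \<circ> \<sigma>) \<longlonglongrightarrow> \<zeta>"
    using compact_cball[of "0::complex" 1] unfolding compact_def by metis
  have "(\<lambda>n. cmod (z n)) \<longlonglongrightarrow> 1"
  proof (rule tendsto_sandwich)
    show "(\<lambda>n. 1 - inverse (real (Suc n))) \<longlonglongrightarrow> 1"
      using tendsto_diff[OF tendsto_const[of 1] LIMSEQ_inverse_real_of_nat] by simp
    show "\<forall>\<^sub>F n in sequentially. cmod (z n) \<le> 1"
      using tz(3) by (auto intro!: always_eventually simp: less_imp_le)
    show "\<forall>\<^sub>F n in sequentially. 1 - inverse (real (Suc n)) \<le> cmod (z n)"
      by (intro always_eventually allI less_imp_le tz)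
  qed auto
  then have "((\<lambda>n. cmod (z n)) \<circ> \<sigma>) \<longlonglongrightarrow> 1" by (rule LIMSEQ_subseq_LIMSEQ[OF _ \<sigma>])
  moreover have "(\<lambda>n. cmod ((z \<circ> \<sigma>) n)) \<longlonglongrightarrow> cmod \<zeta>" by (intro tendsto_norm lim)
  ultimately have "cmod \<zeta> = 1" by (auto simp: o_def intro: LIMSEQ_unique)
  moreover have "\<exists>t z. 0 < t \<and> t < \<eta> \<and> z \<in> unit_disc \<and> cmod (\<zeta> - z) < \<eta> \<and>
           1 / 2 < cmod (Moebius_function 0 (\<phi> t z) z)" if "\<eta> > 0" for \<eta> :: real
  proof -
    have "\<forall>\<^sub>F n in sequentially. inverse (real (Suc n)) < \<eta>"
      using LIMSEQ_inverse_real_of_nat \<open>\<eta> > 0\<close> by (rule order_tendstoD)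
    moreover have "\<forall>\<^sub>F n in sequentially. dist ((z \<circ> \<sigma>) n) \<zeta> < \<eta>"
      using lim \<open>\<eta> > 0\<close> by (rule tendstoD)
    ultimately have "\<forall>\<^sub>F n in sequentially. inverse (real (Suc n)) < \<eta> \<and> dist ((z \<circ> \<sigma>) n) \<zeta> < \<eta>"
      by (rule eventually_conj)
    then obtain n where n: "inverse (real (Suc n)) < \<eta>" "dist (z (\<sigma> n)) \<zeta> < \<eta>"
      by (auto simp: eventually_sequentially)
    have "inverse (real (Suc (\<sigma> n))) \<le> inverse (real (Suc n))"
      using seq_suble[OF \<sigma>, of n] by (intro le_imp_inverse_le) auto
    then have "t (\<sigma> n) < \<eta>" using tz(2)[of "\<sigma> n"] n(1) by linarith
    then show ?thesis
      using tz n(2) by (intro exI[of _ "t (\<sigma> n)"] exI[of _ "z (\<sigma> n)"])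
        (auto simp: dist_norm norm_minus_commute)
  qed
  ultimately show thesis by (rule that)
qed

section \<open>The pointwise Bloch seminorm\<close>

definition bloch_at :: "complex \<Rightarrow> (complex \<Rightarrow> complex) \<Rightarrow> real"
  where "bloch_at z f = cmod (deriv f z) * (1 - (cmod z)\<^sup>2)"

lemma one_minus_norm_sq_pos: "z \<in> unit_disc \<Longrightarrow> 0 < 1 - (cmod z)\<^sup>2"
  by (simp add: abs_square_less_1)

lemma Hol_differentiable:
  "f \<in> Hol unit_disc \<Longrightarrow> z \<in> unit_disc \<Longrightarrow> f field_differentiable at z"
  by (auto simp: Hol_def intro: holomorphic_on_imp_differentiable_at)

lemma bloch_at_add:
  assumes "f \<in> Hol unit_disc" "g \<in> Hol unit_disc" "z \<in> unit_disc"
  shows "bloch_at z (\<lambda>u. f u + g u) \<le> bloch_at z f + bloch_at z g"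
proof -
  have "cmod (deriv (\<lambda>u. f u + g u) z) \<le> cmod (deriv f z) + cmod (deriv g z)"
    using assms by (simp add: Hol_differentiable norm_triangle_ineq)
  then show ?thesis
    using one_minus_norm_sq_pos[OF assms(3)]
    unfolding bloch_at_def distrib_right[symmetric] by (intro mult_right_mono) auto
qed

lemma bloch_at_cmult:
  assumes "f \<in> Hol unit_disc" "z \<in> unit_disc"
  shows "bloch_at z (\<lambda>u. c * f u) = cmod c * bloch_at z f"
  using assms by (simp add: bloch_at_def Hol_differentiable norm_mult)

lemma bloch_at_le_bloch_norm:
  assumes "f \<in> Bloch" "z \<in> unit_disc"
  shows "bloch_at z f \<le> enn2real (bloch_norm f)"
proof -
  have "ennreal (bloch_at z f) \<le> (SUP z\<in>unit_disc. ennreal (cmod (deriv f z) * (1 - (cmod z)\<^sup>2)))"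
    unfolding bloch_at_def by (rule SUP_upper[OF assms(2)])
  also have "\<dots> \<le> bloch_norm f" by (simp add: bloch_norm_def)
  also have "\<dots> = ennreal (enn2real (bloch_norm f))"
    using assms(1) by (simp add: Bloch_def)
  finally show ?thesis by simp
qed

text \<open>
  Cauchy's estimate for the first derivative. The factor \<open>1 - \<bar>z\<bar>\<^sup>2\<close> is bounded by one; the loss near the
  circle is harmless because the bound is only used at one point at a time.
\<close>

lemma bloch_at_le_sup:
  assumes hol: "f holomorphic_on unit_disc" and s: "s > 0" "cball z s \<subseteq> unit_disc"
    and le: "\<And>u. u \<in> cball z s \<Longrightarrow> cmod (f u) \<le> B"
  shows "bloch_at z f \<le> B / s"
proof -
  have "cmod ((deriv ^^ 1) f z) \<le> fact 1 * B / s ^ 1"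
  proof (rule Cauchy_inequality)
    show "f holomorphic_on ball z s"
      by (rule holomorphic_on_subset[OF hol]) (use s ball_subset_cball in blast)
    show "continuous_on (cball z s) f"
      by (rule holomorphic_on_imp_continuous_on[OF holomorphic_on_subset[OF hol s(2)]])
    show "cmod (f x) \<le> B" if "cmod (z - x) = s" for x
      using le[of x] that by (simp add: dist_norm)
  qed (use s in auto)
  then have "cmod (deriv f z) \<le> B / s" by simp
  moreover have "bloch_at z f \<le> cmod (deriv f z) * 1"
    unfolding bloch_at_def by (intro mult_left_mono) auto
  ultimately show ?thesis by simp
qed


section \<open>Bounded functions concentrated near a boundary point at a given scale\<close>

text \<open>
  The double pole is moved outside the disc to distance \<open>\<epsilon>\<close> from \<open>\<zeta>\<close>, so that the modulus is comparable
  to \<open>min (\<epsilon> / d) (d / \<epsilon>)\<close> with \<open>d = \<bar>\<zeta> - u\<bar>\<close>, uniformly in all of the disc and not only in a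
  nontangential region. This matters because the points \<open>z n\<close> may approach \<open>\<zeta>\<close> tangentially.
\<close>

definition peak :: "complex \<Rightarrow> real \<Rightarrow> complex \<Rightarrow> complex"
  where "peak \<zeta> \<epsilon> u = of_real \<epsilon> * (\<zeta> - u) / ((1 + of_real \<epsilon>) * \<zeta> - u)\<^sup>2"

text \<open>
  The distance is at least \<open>\<epsilon>\<close> by the triangle inequality. It is also at least \<open>\<bar>\<zeta> - u\<bar>\<close>, since moving
  \<open>\<zeta>\<close> along the outer normal increases the distance to every point of the convex set. The stated
  bound is the average of the two.
\<close>

lemma dist_dilated_boundary_point:
  assumes \<zeta>: "cmod \<zeta> = 1" and u: "u \<in> unit_disc" and \<epsilon>: "\<epsilon> \<ge> 0"
  shows "(\<epsilon> + cmod (\<zeta> - u)) / 2 \<le> cmod ((1 + of_real \<epsilon>) * \<zeta> - u)"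
proof -
  have "cmod ((1 + of_real \<epsilon>) * \<zeta>) = 1 + \<epsilon>"
    using \<zeta> \<epsilon> norm_of_real[of "1 + \<epsilon>", where 'a = complex] by (simp add: norm_mult del: norm_of_real)
  then have 1: "\<epsilon> \<le> cmod ((1 + of_real \<epsilon>) * \<zeta> - u)"
    using u norm_triangle_ineq2[of "(1 + of_real \<epsilon>) * \<zeta>" u] by simp
  have "\<zeta> \<bullet> u \<le> cmod \<zeta> * cmod u" by (rule norm_cauchy_schwarz)
  also have "\<dots> \<le> 1" using \<zeta> u by simp
  finally have "0 \<le> (\<zeta> - u) \<bullet> \<zeta>"
    using \<zeta> by (simp add: inner_diff_left inner_commute[of u] norm_eq_1)
  then have "(cmod (\<zeta> - u))\<^sup>2 \<le> (cmod ((\<zeta> - u) + \<epsilon> *\<^sub>R \<zeta>))\<^sup>2"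
    unfolding power2_norm_eq_inner using \<epsilon>
    by (simp add: inner_add_left inner_add_right inner_commute)
  then have "cmod (\<zeta> - u) \<le> cmod ((\<zeta> - u) + \<epsilon> *\<^sub>R \<zeta>)"
    by (rule power2_le_imp_le) simp
  also have "(\<zeta> - u) + \<epsilon> *\<^sub>R \<zeta> = (1 + of_real \<epsilon>) * \<zeta> - u"
    by (simp add: algebra_simps scaleR_conv_of_real)
  finally show ?thesis using 1 by simp
qed

lemma boundary_point_dist_pos:
  "cmod \<zeta> = 1 \<Longrightarrow> u \<in> unit_disc \<Longrightarrow> 0 < cmod (\<zeta> - u)"
  by auto

lemma norm_peak_le:
  assumes "cmod \<zeta> = 1" "u \<in> unit_disc" "\<epsilon> > 0"
  shows "cmod (peak \<zeta> \<epsilon> u) \<le> 4 * (\<epsilon> * cmod (\<zeta> - u) / (\<epsilon> + cmod (\<zeta> - u))\<^sup>2)"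
proof -
  define d where "d = cmod (\<zeta> - u)"
  have d: "d > 0" using boundary_point_dist_pos assms by (simp add: d_def)
  have "((\<epsilon> + d) / 2)\<^sup>2 \<le> (cmod ((1 + of_real \<epsilon>) * \<zeta> - u))\<^sup>2"
    using dist_dilated_boundary_point[of \<zeta> u \<epsilon>] assms d by (intro power_mono) (auto simp: d_def)
  moreover have "0 < ((\<epsilon> + d) / 2)\<^sup>2" using d assms by simp
  ultimately have "\<epsilon> * d / (cmod ((1 + of_real \<epsilon>) * \<zeta> - u))\<^sup>2 \<le> \<epsilon> * d / ((\<epsilon> + d) / 2)\<^sup>2"
    using d assms by (intro divide_left_mono mult_pos_pos) auto
  also have "\<dots> = 4 * (\<epsilon> * d / (\<epsilon> + d)\<^sup>2)" by (simp add: power_divide)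
  finally show ?thesis
    using assms(3) unfolding peak_def d_def by (simp add: norm_divide norm_mult norm_power)
qed

text \<open>
  At a point at distance exactly \<open>\<epsilon>\<close> from \<open>\<zeta>\<close> the numerator is \<open>\<epsilon>\<^sup>2\<close> in modulus, and the pole is at
  distance at most \<open>2 \<epsilon>\<close>.
\<close>

lemma norm_peak_at_scale:
  assumes "cmod \<zeta> = 1" "z \<in> unit_disc"
  shows "1 / 4 \<le> cmod (peak \<zeta> (cmod (\<zeta> - z)) z)"
proof -
  define \<epsilon> where "\<epsilon> = cmod (\<zeta> - z)"
  have \<epsilon>: "\<epsilon> > 0" using boundary_point_dist_pos assms by (simp add: \<epsilon>_def)
  have "cmod ((1 + of_real \<epsilon>) * \<zeta> - z) = cmod ((\<zeta> - z) + of_real \<epsilon> * \<zeta>)"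
    by (simp add: algebra_simps)
  also have "\<dots> \<le> \<epsilon> + \<epsilon>"
    using assms \<epsilon> by (intro norm_triangle_le) (simp add: norm_mult \<epsilon>_def)
  finally have "(cmod ((1 + of_real \<epsilon>) * \<zeta> - z))\<^sup>2 \<le> (2 * \<epsilon>)\<^sup>2"
    by (intro power_mono) auto
  moreover have "\<epsilon> \<le> cmod ((1 + of_real \<epsilon>) * \<zeta> - z)"
    using dist_dilated_boundary_point[OF assms, of \<epsilon>] \<epsilon>
    unfolding \<epsilon>_def[symmetric] by simp
  then have "0 < cmod ((1 + of_real \<epsilon>) * \<zeta> - z)" using \<epsilon> by linarith
  ultimately have "\<epsilon> * \<epsilon> / (2 * \<epsilon>)\<^sup>2 \<le> \<epsilon> * \<epsilon> / (cmod ((1 + of_real \<epsilon>) * \<zeta> - z))\<^sup>2"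
    using \<epsilon> by (intro divide_left_mono) auto
  moreover have "\<epsilon> * \<epsilon> / (2 * \<epsilon>)\<^sup>2 = 1 / 4" using \<epsilon> by (simp add: power2_eq_square)
  moreover have "cmod (peak \<zeta> \<epsilon> z) = \<epsilon> * \<epsilon> / (cmod ((1 + of_real \<epsilon>) * \<zeta> - z))\<^sup>2"
    using \<epsilon> by (simp add: peak_def norm_divide norm_mult norm_power \<epsilon>_def)
  ultimately show ?thesis by (simp add: \<epsilon>_def)
qed

lemma peak_holomorphic:
  assumes "cmod \<zeta> = 1" "\<epsilon> > 0"
  shows "peak \<zeta> \<epsilon> holomorphic_on unit_disc"
proof -
  have "0 < cmod ((1 + of_real \<epsilon>) * \<zeta> - u)" if "u \<in> unit_disc" for u
    using dist_dilated_boundary_point[OF assms(1) that] assms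
      boundary_point_dist_pos[OF assms(1) that] by (smt (verit) divide_pos_pos)
  then show ?thesis
    unfolding peak_def by (intro holomorphic_intros) auto
qed

text \<open>
  The squared factor supplies the double zero at \<open>w\<close> that annihilates the derivative of the weighted
  composition; the simple zero at \<open>z\<close> makes the derivative there as large as the Bloch condition
  permits, up to a constant.
\<close>

definition hump :: "complex \<Rightarrow> complex \<Rightarrow> complex \<Rightarrow> complex \<Rightarrow> complex"
  where "hump \<zeta> z w = zero_ext unit_disc (\<lambda>u.
    (Moebius_function 0 w u)\<^sup>2 * Moebius_function 0 z u * peak \<zeta> (cmod (\<zeta> - z)) u)"

lemma hump_in_Hol:
  assumes "cmod \<zeta> = 1" "z \<in> unit_disc" "w \<in> unit_disc"
  shows "hump \<zeta> z w \<in> Hol unit_disc"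
proof -
  have "(\<lambda>u. (Moebius_function 0 w u)\<^sup>2 * Moebius_function 0 z u * peak \<zeta> (cmod (\<zeta> - z)) u)
      holomorphic_on unit_disc"
    using assms boundary_point_dist_pos[of \<zeta> z]
    by (intro holomorphic_intros Moebius_function_holomorphic peak_holomorphic) auto
  then have "hump \<zeta> z w holomorphic_on unit_disc"
    by (rule holomorphic_transform) (simp add: hump_def zero_ext_def)
  then show ?thesis by (simp add: Hol_def hump_def zero_ext_def)
qed

lemma norm_hump_le:
  assumes "cmod \<zeta> = 1" "z \<in> unit_disc" "w \<in> unit_disc" "u \<in> unit_disc" and "\<epsilon> = cmod (\<zeta> - z)"
  shows "cmod (hump \<zeta> z w u) \<le> 4 * (\<epsilon> * cmod (\<zeta> - u) / (\<epsilon> + cmod (\<zeta> - u))\<^sup>2)"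
proof -
  have M: "cmod (Moebius_function 0 a u) \<le> 1" if "a \<in> unit_disc" for a
    using Moebius_function_norm_lt_1[of a u 0] assms(4) that by simp
  have "cmod (hump \<zeta> z w u) = (cmod (Moebius_function 0 w u))\<^sup>2 * cmod (Moebius_function 0 z u)
      * cmod (peak \<zeta> \<epsilon> u)"
    using assms by (simp add: hump_def zero_ext_def norm_mult norm_power)
  also have "\<dots> \<le> 1 * cmod (peak \<zeta> \<epsilon> u)"
    using M assms by (intro mult_right_mono mult_le_one power_le_one) auto
  also have "\<dots> \<le> 4 * (\<epsilon> * cmod (\<zeta> - u) / (\<epsilon> + cmod (\<zeta> - u))\<^sup>2)"
    using norm_peak_le[of \<zeta> u \<epsilon>] boundary_point_dist_pos[of \<zeta> z] assms by simp
  finally show ?thesis .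
qed

lemma Moebius_function_deriv_at_zero:
  assumes "z \<in> unit_disc"
  shows "(Moebius_function 0 z has_field_derivative 1 / of_real (1 - (cmod z)\<^sup>2)) (at z)"
proof -
  have eq: "1 - cnj z * z = of_real (1 - (cmod z)\<^sup>2)"
    by (simp add: complex_norm_square mult.commute del: of_real_power)
  have "(cmod z)\<^sup>2 < 1" using assms by (simp add: abs_square_less_1)
  then have nz: "1 - cnj z * z \<noteq> 0" unfolding eq by (simp only: of_real_eq_0_iff)
  have "((\<lambda>u. (u - z) / (1 - cnj z * u)) has_field_derivative 1 / (1 - cnj z * z)) (at z)"
    using nz by (auto intro!: derivative_eq_intros simp: power2_eq_square)
  then show ?thesis
    unfolding eq by (simp add: Moebius_function_simple[abs_def] del: of_real_diff)
qed

text \<open>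
  The derivative at the simple zero \<open>z\<close> is \<open>1 / (1 - \<bar>z\<bar>\<^sup>2)\<close> times the value of the cofactor, which is at
  least \<open>(1/2)\<^sup>2 \<cdot> 1/4\<close> in modulus.
\<close>

lemma bloch_at_hump:
  assumes \<zeta>: "cmod \<zeta> = 1" and z: "z \<in> unit_disc" and w: "w \<in> unit_disc"
    and far: "1 / 2 < cmod (Moebius_function 0 w z)"
  shows "1 / 16 \<le> bloch_at z (hump \<zeta> z w)"
proof -
  let ?P = "peak \<zeta> (cmod (\<zeta> - z))" and ?c = "1 - (cmod z)\<^sup>2"
  define q where "q u = (Moebius_function 0 w u)\<^sup>2 * ?P u" for u
  have c: "?c > 0" using z by (simp add: abs_square_less_1)
  have "q holomorphic_on unit_disc"
    unfolding q_def using assms boundary_point_dist_pos[of \<zeta> z]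
    by (intro holomorphic_intros Moebius_function_holomorphic peak_holomorphic) auto
  then have q': "(q has_field_derivative deriv q z) (at z)"
    using z by (intro holomorphic_derivI[of q unit_disc]) auto
  have "((\<lambda>u. Moebius_function 0 z u * q u) has_field_derivative q z / of_real ?c) (at z)"
    using DERIV_mult'[OF Moebius_function_deriv_at_zero[OF z] q']
    by (simp add: Moebius_function_eq_zero del: of_real_diff)
  then have "(hump \<zeta> z w has_field_derivative q z / of_real ?c) (at z)"
    by (rule has_field_derivative_transform_within_open[where S = unit_disc])
      (use z in \<open>auto simp: hump_def zero_ext_def q_def\<close>)
  then have "deriv (hump \<zeta> z w) z = q z / of_real ?c" by (rule DERIV_imp_deriv)
  then have "bloch_at z (hump \<zeta> z w) = cmod (q z)"
    using c unfolding bloch_at_def by (simp add: norm_divide del: of_real_diff)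
  also have "\<dots> = (cmod (Moebius_function 0 w z))\<^sup>2 * cmod (?P z)"
    by (simp add: q_def norm_mult norm_power)
  also have "\<dots> \<ge> (1 / 2)\<^sup>2 * (1 / 4)"
    using far norm_peak_at_scale[OF \<zeta> z] by (intro mult_mono power_mono) auto
  finally show ?thesis by (simp add: power2_eq_square)
qed

lemma hump_in_H_infinity:
  assumes "cmod \<zeta> = 1" "z \<in> unit_disc" "w \<in> unit_disc"
  shows "hump \<zeta> z w \<in> H_infinity"
proof -
  have "cmod (hump \<zeta> z w u) \<le> 4" if u: "u \<in> unit_disc" for u
  proof -
    define \<epsilon> d where "\<epsilon> = cmod (\<zeta> - z)" and "d = cmod (\<zeta> - u)"
    have pos: "\<epsilon> > 0" "d > 0"
      using boundary_point_dist_pos assms u by (auto simp: \<epsilon>_def d_def)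
    then have "\<epsilon> * d \<le> (\<epsilon> + d)\<^sup>2" by (simp add: power2_eq_square algebra_simps)
    then have "\<epsilon> * d / (\<epsilon> + d)\<^sup>2 \<le> 1" using pos by (simp add: divide_le_eq)
    then show ?thesis using norm_hump_le[OF assms u \<epsilon>_def] by (simp add: d_def)
  qed
  then show ?thesis
    using hump_in_Hol[OF assms] by (auto simp: H_infinity_def bounded_iff intro!: exI[of _ 4])
qed


section \<open>Lacunary sums\<close>

text \<open>
  Each term is at most twice the decrement of \<open>\<epsilon> / (\<epsilon> + d)\<close> from one scale to the next. The resulting
  bound is independent of \<open>d\<close>, which is what makes a sum of humps bounded up to the boundary.
\<close>

lemma lacunary_telescoping:
  fixes \<epsilon> :: "nat \<Rightarrow> real"
  assumes pos: "\<And>k. \<epsilon> k > 0" and half: "\<And>k. \<epsilon> (Suc k) \<le> \<epsilon> k / 2" and "d > 0"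
  shows "(\<Sum>k<n. \<epsilon> k * d / (\<epsilon> k + d)\<^sup>2) \<le> 2 * (\<epsilon> 0 / (\<epsilon> 0 + d) - \<epsilon> n / (\<epsilon> n + d))"
proof (induction n)
  case (Suc n)
  let ?e = "\<epsilon> n" and ?e' = "\<epsilon> (Suc n)"
  note * = pos[of n] pos[of "Suc n"] half[of n] \<open>d > 0\<close>
  have "?e * d / (?e + d)\<^sup>2 = 2 * ((?e / 2 * d) / ((?e + d) * (?e + d)))"
    by (simp add: power2_eq_square)
  also have "\<dots> \<le> 2 * (((?e - ?e') * d) / ((?e + d) * (?e' + d)))"
    using * by (intro mult_left_mono frac_le mult_right_mono mult_pos_pos mult_mono) auto
  also have "\<dots> = 2 * (?e / (?e + d) - ?e' / (?e' + d))"
    using * by (simp add: diff_frac_eq add_pos_pos[THEN less_imp_neq, symmetric] algebra_simps)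
  finally show ?case using Suc.IH by simp
qed simp

text \<open>
  Boundedness comes from the two-sided decay of the terms, through the telescoping estimate.
  Convergence and the estimate of the tails use only the decay \<open>\<epsilon> / d\<close> away from \<open>\<zeta>\<close>, against which
  the scales form a series dominated by a geometric one.
\<close>

lemma lacunary_sum:
  fixes \<epsilon> :: "nat \<Rightarrow> real" and f :: "nat \<Rightarrow> complex \<Rightarrow> complex"
  assumes \<zeta>: "cmod \<zeta> = 1"
    and pos: "\<And>k. \<epsilon> k > 0" and half: "\<And>k. \<epsilon> (Suc k) \<le> \<epsilon> k / 2"
    and Hol: "\<And>k. f k \<in> Hol unit_disc"
    and le: "\<And>k u. u \<in> unit_disc \<Longrightarrow>
      cmod (f k u) \<le> 4 * (\<epsilon> k * cmod (\<zeta> - u) / (\<epsilon> k + cmod (\<zeta> - u))\<^sup>2)"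
  obtains F where "F \<in> H_infinity"
    and "\<And>n u. u \<in> unit_disc \<Longrightarrow> cmod (F u - (\<Sum>k<n. f k u)) \<le> 8 * \<epsilon> n / cmod (\<zeta> - u)"
proof -
  have geom: "\<epsilon> (k + n) \<le> \<epsilon> n * (1 / 2) ^ k" for k n
    by (induction k) (use half in \<open>auto intro: order_trans\<close>)
  have le': "cmod (f k u) \<le> 4 * \<epsilon> k / cmod (\<zeta> - u)" if u: "u \<in> unit_disc" for k u
  proof -
    define d where "d = cmod (\<zeta> - u)"
    have d: "d > 0" using boundary_point_dist_pos[OF \<zeta> u] by (simp add: d_def)
    have "\<epsilon> k * d / (\<epsilon> k + d)\<^sup>2 \<le> \<epsilon> k * d / (d * d)"
      using d pos[of k]
      by (intro divide_left_mono) (auto simp: power2_eq_square intro!: mult_mono)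
    then show ?thesis using le[OF u, of k] d by (simp add: d_def)
  qed
  have tail_le: "cmod (f (k + n) u) \<le> 4 * \<epsilon> n / cmod (\<zeta> - u) * (1 / 2) ^ k"
    if u: "u \<in> unit_disc" for k n u
  proof -
    have "4 * \<epsilon> (k + n) / cmod (\<zeta> - u) \<le> 4 * (\<epsilon> n * (1 / 2) ^ k) / cmod (\<zeta> - u)"
      by (intro divide_right_mono mult_left_mono geom) auto
    then show ?thesis using le'[OF u, of "k + n"] by simp
  qed
  have geo_sum: "summable (\<lambda>k. c * (1 / 2) ^ k)" for c :: real
    by (intro summable_mult summable_geometric) auto
  have sm: "summable (\<lambda>k. f k u)" if u: "u \<in> unit_disc" for u
    by (rule summable_comparison_test'[OF geo_sum[of "4 * \<epsilon> 0 / cmod (\<zeta> - u)"], of 0])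
      (use tail_le[OF u, of _ 0] in simp)
  define F where "F u = (\<Sum>k. f k u)" for u
  have "F holomorphic_on unit_disc"
  proof (rule holomorphic_uniform_sequence[where f = "\<lambda>n u. \<Sum>k<n. f k u"])
    show "(\<lambda>u. \<Sum>k<n. f k u) holomorphic_on unit_disc" for n
      using Hol by (intro holomorphic_intros) (auto simp: Hol_def)
    fix x :: complex assume x: "x \<in> unit_disc"
    define r where "r = (1 - cmod x) / 2"
    have r: "r > 0" using x by (simp add: r_def)
    have far: "u \<in> unit_disc \<and> r \<le> cmod (\<zeta> - u)" if "u \<in> cball x r" for u
    proof -
      have "cmod u \<le> cmod x + r"
        using that norm_triangle_sub[of u x] by (simp add: dist_norm norm_minus_commute)
      moreover have "cmod x + r = 1 - r" by (simp add: r_def field_simps)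
      moreover have "cmod \<zeta> - cmod u \<le> cmod (\<zeta> - u)" by (rule norm_triangle_ineq2)
      ultimately show ?thesis using r \<zeta> by simp
    qed
    have "uniform_limit (cball x r) (\<lambda>n u. \<Sum>k<n. f k u) (\<lambda>u. \<Sum>k. f k u) sequentially"
    proof (rule Weierstrass_m_test[OF _ geo_sum])
      fix k u assume "u \<in> cball x r"
      then have u: "u \<in> unit_disc" "r \<le> cmod (\<zeta> - u)" using far by auto
      have "4 * \<epsilon> 0 / cmod (\<zeta> - u) * (1 / 2) ^ k \<le> 4 * \<epsilon> 0 / r * (1 / 2) ^ k"
        using u r pos[of 0] by (intro mult_right_mono frac_le) auto
      then show "cmod (f k u) \<le> 4 * \<epsilon> 0 / r * (1 / 2) ^ k"
        using tail_le[OF u(1), of k 0] by simp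
    qed
    then show "\<exists>d>0. cball x d \<subseteq> unit_disc \<and>
        uniform_limit (cball x d) (\<lambda>n u. \<Sum>k<n. f k u) F sequentially"
      using r far unfolding F_def[abs_def] by blast
  qed auto
  moreover have "F u = 0" if "u \<notin> unit_disc" for u
    using Hol that by (simp add: F_def Hol_def)
  moreover have "cmod (F u) \<le> 8" if u: "u \<in> unit_disc" for u
  proof (rule Lim_bounded)
    show "(\<lambda>n. cmod (\<Sum>k<n. f k u)) \<longlonglongrightarrow> cmod (F u)"
      unfolding F_def by (intro tendsto_norm summable_LIMSEQ sm u)
    show "\<forall>n\<ge>0. cmod (\<Sum>k<n. f k u) \<le> 8"
    proof (intro allI impI)
      fix n
      define d where "d = cmod (\<zeta> - u)"
      have d: "d > 0" using boundary_point_dist_pos[OF \<zeta> u] by (simp add: d_def)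
      have "cmod (\<Sum>k<n. f k u) \<le> (\<Sum>k<n. 4 * (\<epsilon> k * d / (\<epsilon> k + d)\<^sup>2))"
        unfolding d_def by (intro sum_norm_le le u)
      also have "\<dots> \<le> 4 * (2 * (\<epsilon> 0 / (\<epsilon> 0 + d) - \<epsilon> n / (\<epsilon> n + d)))"
        unfolding sum_distrib_left[symmetric]
        by (intro mult_left_mono lacunary_telescoping pos half d) auto
      also have "\<epsilon> 0 / (\<epsilon> 0 + d) - \<epsilon> n / (\<epsilon> n + d) \<le> 1 - 0"
        using pos[of 0] pos[of n] d by (intro diff_mono) auto
      finally show "cmod (\<Sum>k<n. f k u) \<le> 8" by simp
    qed
  qed
  ultimately have "F \<in> H_infinity"
    by (auto simp: H_infinity_def Hol_def bounded_iff intro!: exI[of _ 8])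
  moreover have "cmod (F u - (\<Sum>k<n. f k u)) \<le> 8 * \<epsilon> n / cmod (\<zeta> - u)"
    if u: "u \<in> unit_disc" for n u
  proof -
    have "F u - (\<Sum>k<n. f k u) = (\<Sum>k. f (k + n) u)"
      unfolding F_def by (rule suminf_minus_initial_segment[OF sm[OF u], symmetric])
    also have "cmod \<dots> \<le> (\<Sum>k. 4 * \<epsilon> n / cmod (\<zeta> - u) * (1 / 2) ^ k)"
      by (intro norm_suminf_le tail_le u geo_sum)
    also have "\<dots> = 4 * \<epsilon> n / cmod (\<zeta> - u) * 2"
      by (subst suminf_mult) (auto simp: suminf_geometric intro: summable_geometric)
    finally show ?thesis by simp
  qed
  ultimately show thesis by (rule that)
qed

section \<open>Boundedness of the inclusion in the Bloch space\<close>

text \<open>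
  The Banach--Steinhaus theorem for seminorms. The sets \<open>U k\<close> on which all seminorms are at most \<open>k\<close>
  are closed and cover \<open>X\<close>, so by Baire one of them contains a ball, and by symmetry and
  subadditivity all seminorms are bounded on a ball around zero.
\<close>

lemma (in banach_analytic_space) uniform_boundedness:
  fixes p :: "'i \<Rightarrow> (complex \<Rightarrow> complex) \<Rightarrow> real"
  assumes subadd: "\<And>i f g. i \<in> I \<Longrightarrow> f \<in> X \<Longrightarrow> g \<in> X \<Longrightarrow> p i (\<lambda>z. f z + g z) \<le> p i f + p i g"
    and homog: "\<And>i f c. i \<in> I \<Longrightarrow> f \<in> X \<Longrightarrow> p i (\<lambda>z. c * f z) = cmod c * p i f"
    and cont: "\<And>i. i \<in> I \<Longrightarrow> \<exists>C. \<forall>f\<in>X. p i f \<le> C * N f"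
    and pointwise: "\<And>f. f \<in> X \<Longrightarrow> \<exists>C. \<forall>i\<in>I. p i f \<le> C"
  shows "\<exists>C. \<forall>i\<in>I. \<forall>f\<in>X. p i f \<le> C * N f"
proof -
  define U where "U k = {f \<in> X. \<forall>i\<in>I. p i f \<le> real k}" for k :: nat
  have closed: "closedin mtopology (U k)" for k
    unfolding closedin_metric
  proof (intro conjI allI impI)
    show "U k \<subseteq> X" by (auto simp: U_def)
    fix f assume "f \<in> X - U k"
    then obtain i where f: "f \<in> X" and i: "i \<in> I" and big: "p i f > real k"
      by (auto simp: U_def not_le)
    obtain C where C: "\<And>g. g \<in> X \<Longrightarrow> p i g \<le> C * N g"
      using cont[OF i] by blast
    define r where "r = (p i f - real k) / (\<bar>C\<bar> + 1)"
    have "r > 0" using big by (simp add: r_def)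
    moreover have "disjnt (U k) (mball f r)"
      unfolding disjnt_iff
    proof (intro allI notI, elim conjE)
      fix g assume "g \<in> U k" "g \<in> mball f r"
      then have g: "g \<in> X" "p i g \<le> real k" "N (\<lambda>z. f z - g z) < r"
        using i by (auto simp: U_def norm_dist_def)
      have "p i f \<le> p i g + p i (\<lambda>z. f z - g z)"
        using subadd[OF i g(1) diff[OF f g(1)]] by simp
      also have "p i (\<lambda>z. f z - g z) \<le> (\<bar>C\<bar> + 1) * N (\<lambda>z. f z - g z)"
        using C[OF diff[OF f g(1)]] norm_nonneg[OF diff[OF f g(1)]]
        by (smt (verit) mult_right_mono)
      also have "\<dots> < (\<bar>C\<bar> + 1) * r"
        using g(3) by (intro mult_strict_left_mono) auto
      also have "\<dots> = p i f - real k" by (simp add: r_def)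
      finally show False using g(2) by simp
    qed
    ultimately show "\<exists>r>0. disjnt (U k) (mball f r)" by blast
  qed
  have "\<Union>(range U) = X"
  proof
    show "X \<subseteq> \<Union>(range U)"
    proof
      fix f assume f: "f \<in> X"
      then obtain C where "\<forall>i\<in>I. p i f \<le> C" using pointwise by blast
      moreover obtain k where "C \<le> real k" using real_arch_simple by blast
      ultimately have "f \<in> U k" using f by (force simp: U_def)
      then show "f \<in> \<Union>(range U)" by blast
    qed
  qed (auto simp: U_def)
  then have "mtopology interior_of \<Union>(range U) \<noteq> {}"
    using interior_of_topspace[of mtopology] zero by auto
  with metric_Baire_category_alt[OF complete, of "range U"] closed
  obtain k where "mtopology interior_of U k \<noteq> {}" by auto
  then obtain f0 r where r: "f0 \<in> X" "r > 0" "mball f0 r \<subseteq> U k"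
    by (metis all_not_in_conv in_interior_of_mball)
  have small: "p i f \<le> 2 * real k" if i: "i \<in> I" and f: "f \<in> X" "N f < r" for i f
  proof -
    have "norm_dist X N f0 (\<lambda>z. f0 z + f z) = N f"
      using r(1) f norm_scale[OF f(1), of "-1"] by (simp add: norm_dist_def add)
    then have "(\<lambda>z. f0 z + f z) \<in> U k"
      using r f add by auto
    then have 1: "p i (\<lambda>z. f0 z + f z) \<le> real k" using i by (simp add: U_def)
    have "f0 \<in> U k" using r by auto
    then have 2: "p i (\<lambda>z. - 1 * f0 z) \<le> real k"
      using i homog[OF i r(1), of "-1"] by (simp add: U_def)
    have "p i (\<lambda>z. (f0 z + f z) + - 1 * f0 z) \<le>
        p i (\<lambda>z. f0 z + f z) + p i (\<lambda>z. - 1 * f0 z)"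
      by (rule subadd[OF i add[OF r(1) f(1)] scale[OF r(1)]])
    then show ?thesis using 1 2 by simp
  qed
  have "p i f \<le> (4 * real k / r) * N f" if i: "i \<in> I" and f: "f \<in> X" for i f
  proof (cases "N f = 0")
    case True
    then have "f = (\<lambda>z. 0)" using norm_eq_0[OF f] by simp
    then have "p i f = 0" using homog[OF i f, of 0] by simp
    then show ?thesis using True by simp
  next
    case False
    then have pos: "N f > 0" using norm_nonneg[OF f] by simp
    define c where "c = r / (2 * N f)"
    have c: "c > 0" using r pos by (simp add: c_def)
    have "N (\<lambda>z. of_real c * f z) = c * N f"
      using norm_scale[OF f, of "of_real c"] c by simp
    also have "\<dots> = r / 2" using pos by (simp add: c_def)
    finally have "N (\<lambda>z. of_real c * f z) = r / 2" .
    then have "p i (\<lambda>z. of_real c * f z) \<le> 2 * real k"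
      using r by (intro small i scale f) auto
    then have "c * p i f \<le> 2 * real k"
      using homog[OF i f, of "of_real c"] c by simp
    then show ?thesis using c pos r(2) by (simp add: c_def field_simps)
  qed
  then show ?thesis by blast
qed


text \<open>
  The set is open because a continuous function smaller than \<open>e\<close> on a compact set stays away from
  \<open>e\<close> by a fixed amount.
\<close>

lemma openin_Hol_topology_sup_less:
  assumes "compact K" "K \<subseteq> U"
  shows "openin (Hol_topology U) {g \<in> Hol U. \<forall>z\<in>K. cmod (g z) < e}"
  unfolding openin_Hol_topology
proof (intro conjI ballI)
  fix f assume f: "f \<in> {g \<in> Hol U. \<forall>z\<in>K. cmod (g z) < e}"
  have "continuous_on K (\<lambda>z. cmod (f z))"
    using f assms(2) unfolding Hol_def
    by (auto intro!: continuous_intros holomorphic_on_imp_continuous_on intro: holomorphic_on_subset)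
  then obtain d where d: "d > 0" "\<And>z. z \<in> K \<Longrightarrow> cmod (f z) + d \<le> e"
  proof (cases "K = {}")
    case True then show thesis using that[of 1] by auto
  next
    case False
    then obtain x where x: "x \<in> K" "\<And>z. z \<in> K \<Longrightarrow> cmod (f z) \<le> cmod (f x)"
      using continuous_attains_sup[OF assms(1) False \<open>continuous_on K _\<close>] by blast
    show thesis
      by (rule that[of "e - cmod (f x)"]) (use x f in auto)
  qed
  have "cmod (g z) < e" if "dist (g z) (f z) < d" "z \<in> K" for g :: "complex \<Rightarrow> complex" and z
    using d(2)[OF that(2)] that(1) norm_triangle_sub[of "g z" "f z"] by (simp add: dist_norm)
  then show "\<exists>K' d. compact K' \<and> K' \<subseteq> U \<and> d > 0 \<and>
      {g \<in> Hol U. \<forall>z\<in>K'. dist (g z) (f z) < d} \<subseteq> {g \<in> Hol U. \<forall>z\<in>K. cmod (g z) < e}"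
    using assms d(1) by (intro exI[of _ K] exI[of _ d]) auto
qed auto

lemma (in normed_analytic_space) bloch_at_continuous:
  assumes cont: "continuous_map (norm_topology X N) (Hol_topology unit_disc) (\<lambda>f. f)"
    and z: "z \<in> unit_disc"
  shows "\<exists>C. \<forall>f\<in>X. bloch_at z f \<le> C * N f"
proof -
  obtain s where s: "s > 0" "cball z s \<subseteq> unit_disc"
    using z open_ball[of "0::complex" 1] open_contains_cball_eq by blast
  define W where "W = {g \<in> Hol unit_disc. \<forall>u\<in>cball z s. cmod (g u) < 1}"
  have "openin (Hol_topology unit_disc) W"
    unfolding W_def using s by (intro openin_Hol_topology_sup_less) auto
  then have "openin mtopology {f \<in> X. f \<in> W}"
    using openin_continuous_map_preimage[OF cont] by (simp add: norm_topology_def)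
  moreover have "(\<lambda>z. 0) \<in> {f \<in> X. f \<in> W}"
    using zero by (auto simp: W_def Hol_def)
  ultimately obtain r where r: "r > 0" "mball (\<lambda>z. 0) r \<subseteq> {f \<in> X. f \<in> W}"
    unfolding openin_mtopology by blast
  have small: "bloch_at z f \<le> 1 / s" if f: "f \<in> X" "N f < r" for f
  proof -
    have "N (\<lambda>z. - f z) = N f"
      using norm_scale[OF f(1), of "-1"] by simp
    then have "f \<in> mball (\<lambda>z. 0) r"
      using f zero by (simp add: norm_dist_def)
    then have "f \<in> W" using r(2) by blast
    then have hol: "f holomorphic_on unit_disc" and le: "\<And>u. u \<in> cball z s \<Longrightarrow> cmod (f u) < 1"
      by (auto simp: W_def Hol_def)
    show ?thesis
      using bloch_at_le_sup[OF hol s less_imp_le[OF le]] by simp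
  qed
  have "bloch_at z f \<le> (2 / (s * r)) * N f" if f: "f \<in> X" for f
  proof (cases "N f = 0")
    case True
    then have "f = (\<lambda>z. 0)" using norm_eq_0[OF f] by simp
    then show ?thesis using True by (simp add: bloch_at_def)
  next
    case False
    then have pos: "N f > 0" using norm_nonneg[OF f] by simp
    define c where "c = r / (2 * N f)"
    have c: "c > 0" using r pos by (simp add: c_def)
    have "N (\<lambda>z. of_real c * f z) = c * N f"
      using norm_scale[OF f, of "of_real c"] c by simp
    also have "\<dots> = r / 2" using pos by (simp add: c_def)
    finally have "N (\<lambda>z. of_real c * f z) = r / 2" .
    then have "bloch_at z (\<lambda>z. of_real c * f z) \<le> 1 / s"
      using r by (intro small scale f) auto
    then have "c * bloch_at z f \<le> 1 / s"
      using bloch_at_cmult[of f z "of_real c"] f analytic z c by auto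
    then show ?thesis using c pos r(1) s(1) by (simp add: c_def field_simps)
  qed
  then show ?thesis by blast
qed

text \<open>
  Membership in the Bloch space says that the seminorms \<open>bloch_at z\<close> are bounded at each function
  of \<open>X\<close>, and continuity of the embedding in the space of all analytic functions makes each of them
  continuous. Uniform boundedness replaces a closed graph argument.
\<close>

lemma (in banach_analytic_space) Bloch_inclusion_bounded:
  assumes "X \<subseteq> Bloch"
    and "continuous_map (norm_topology X N) (Hol_topology unit_disc) (\<lambda>f. f)"
  shows "\<exists>C. \<forall>z\<in>unit_disc. \<forall>f\<in>X. bloch_at z f \<le> C * N f"
proof (rule uniform_boundedness)
  show "\<exists>C. \<forall>z\<in>unit_disc. bloch_at z f \<le> C" if "f \<in> X" for f
    using that assms(1) bloch_at_le_bloch_norm by blast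
qed (use analytic assms(2) bloch_at_add bloch_at_cmult bloch_at_continuous in blast)+

section \<open>Weighted compositions and the Bloch seminorm\<close>

locale weighted_flow =
  fixes \<phi> m :: "real \<Rightarrow> complex \<Rightarrow> complex"
  assumes flow: "holomorphic_flow \<phi>" and cocycle: "cocycle \<phi> m"
begin

lemma flow_holomorphic: "t \<ge> 0 \<Longrightarrow> \<phi> t holomorphic_on unit_disc"
  and flow_in_disc: "t \<ge> 0 \<Longrightarrow> u \<in> unit_disc \<Longrightarrow> \<phi> t u \<in> unit_disc"
  and cocycle_holomorphic: "t \<ge> 0 \<Longrightarrow> m t holomorphic_on unit_disc"
  using flow cocycle by (simp_all add: holomorphic_flow_def cocycle_def image_subset_iff)

lemma holomorphic_flow_compose:
  assumes "t \<ge> 0" "g holomorphic_on unit_disc"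
  shows "(\<lambda>u. g (\<phi> t u)) holomorphic_on unit_disc"
  using holomorphic_on_compose_gen[OF flow_holomorphic assms(2)] assms(1) flow_in_disc
  by (auto simp: o_def image_subset_iff)

lemma weighted_composition_in_Hol:
  assumes "t \<ge> 0" "f \<in> Hol unit_disc"
  shows "weighted_composition m \<phi> t f \<in> Hol unit_disc"
proof -
  have "(\<lambda>u. m t u * f (\<phi> t u)) holomorphic_on unit_disc"
    using assms by (intro holomorphic_intros cocycle_holomorphic holomorphic_flow_compose)
      (auto simp: Hol_def)
  then have "weighted_composition m \<phi> t f holomorphic_on unit_disc"
    by (rule holomorphic_transform) (simp add: weighted_composition_def zero_ext_def)
  then show ?thesis by (simp add: Hol_def weighted_composition_def zero_ext_def)
qed

definition defect :: "real \<Rightarrow> complex \<Rightarrow> (complex \<Rightarrow> complex) \<Rightarrow> real"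
  where "defect t z f = bloch_at z (\<lambda>u. weighted_composition m \<phi> t f u - f u)"

lemma defect_diff:
  assumes "t \<ge> 0" "z \<in> unit_disc" "f \<in> Hol unit_disc" "g \<in> Hol unit_disc"
  shows "defect t z (\<lambda>u. f u - g u) \<le> defect t z f + defect t z g"
proof -
  let ?D = "\<lambda>h u. weighted_composition m \<phi> t h u - h u"
  have D: "?D h field_differentiable at z" if "h \<in> Hol unit_disc" for h
    using weighted_composition_in_Hol[OF assms(1) that] that assms(2)
    by (intro derivative_intros Hol_differentiable)
  have "?D (\<lambda>u. f u - g u) = (\<lambda>u. ?D f u - ?D g u)"
    by (auto simp: weighted_composition_def zero_ext_def algebra_simps)
  then have "cmod (deriv (?D (\<lambda>u. f u - g u)) z) \<le> cmod (deriv (?D f) z) + cmod (deriv (?D g) z)"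
    using D assms(3,4) by (simp add: norm_triangle_ineq4)
  then show ?thesis
    using one_minus_norm_sq_pos[OF assms(2)]
    unfolding defect_def bloch_at_def distrib_right[symmetric] by (intro mult_right_mono) auto
qed

text \<open>
  The function is a product with the factor \<open>b\<^sup>2\<close>, where \<open>b\<close> vanishes at \<open>z\<close> because \<open>\<phi> t\<close> takes \<open>z\<close> to
  the double zero of the hump.
\<close>

lemma deriv_weighted_composition_hump:
  assumes t: "t \<ge> 0" and \<zeta>: "cmod \<zeta> = 1" and z: "z \<in> unit_disc"
  shows "deriv (weighted_composition m \<phi> t (hump \<zeta> z (\<phi> t z))) z = 0"
proof -
  let ?w = "\<phi> t z"
  have w: "?w \<in> unit_disc" by (rule flow_in_disc[OF t z])
  define r where "r u = m t u *
      (Moebius_function 0 z (\<phi> t u) * peak \<zeta> (cmod (\<zeta> - z)) (\<phi> t u))" for u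
  define b where "b u = Moebius_function 0 ?w (\<phi> t u)" for u
  have "r holomorphic_on unit_disc" "b holomorphic_on unit_disc"
    unfolding r_def b_def using \<zeta> z w boundary_point_dist_pos[of \<zeta> z]
    by (intro holomorphic_intros cocycle_holomorphic[OF t] holomorphic_flow_compose[OF t]
        Moebius_function_holomorphic peak_holomorphic; simp)+
  then have d: "(r has_field_derivative deriv r z) (at z)" "(b has_field_derivative deriv b z) (at z)"
    using z by (auto intro!: holomorphic_derivI[of _ unit_disc])
  have b0: "b z = 0" by (simp add: b_def Moebius_function_eq_zero)
  have "((\<lambda>u. b u * (b u * r u)) has_field_derivative 0) (at z)"
    using DERIV_mult'[OF d(2) DERIV_mult'[OF d(2) d(1)]] b0 by simp
  then have "(weighted_composition m \<phi> t (hump \<zeta> z ?w) has_field_derivative 0) (at z)"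
    by (rule has_field_derivative_transform_within_open[where S = unit_disc])
      (use z flow_in_disc[OF t] in \<open>auto simp: weighted_composition_def hump_def zero_ext_def b_def r_def
         power2_eq_square\<close>)
  then show ?thesis by (rule DERIV_imp_deriv)
qed

lemma defect_hump:
  assumes t: "t \<ge> 0" and \<zeta>: "cmod \<zeta> = 1" and z: "z \<in> unit_disc"
    and far: "1 / 2 < cmod (Moebius_function 0 (\<phi> t z) z)"
  shows "1 / 16 \<le> defect t z (hump \<zeta> z (\<phi> t z))"
proof -
  have h: "hump \<zeta> z (\<phi> t z) \<in> Hol unit_disc"
    by (rule hump_in_Hol[OF \<zeta> z flow_in_disc[OF t z]])
  have "defect t z (hump \<zeta> z (\<phi> t z)) = bloch_at z (hump \<zeta> z (\<phi> t z))"
    unfolding defect_def bloch_at_def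
    using Hol_differentiable[OF h z] Hol_differentiable[OF weighted_composition_in_Hol[OF t h] z]
    by (simp add: deriv_weighted_composition_hump[OF t \<zeta> z])
  then show ?thesis
    using bloch_at_hump[OF \<zeta> z flow_in_disc[OF t z] far] by simp
qed

text \<open>
  For fixed \<open>t\<close> and \<open>z\<close> the defect depends only on the values of \<open>h\<close> on a closed disc around \<open>z\<close> and on
  its image under \<open>\<phi> t\<close>, two compact sets on which \<open>1 / \<bar>\<zeta> - u\<bar>\<close> is bounded. The bound assumed for \<open>h\<close>
  is the one that holds for the tails of a lacunary sum.
\<close>

lemma defect_small_if_dominated:
  assumes t: "t \<ge> 0" and z: "z \<in> unit_disc" and \<zeta>: "cmod \<zeta> = 1" and "\<delta> > 0"
  shows "\<exists>\<eta>>0. \<forall>h\<in>Hol unit_disc.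
    (\<forall>u\<in>unit_disc. cmod (h u) \<le> \<eta> / cmod (\<zeta> - u)) \<longrightarrow> defect t z h \<le> \<delta>"
proof -
  obtain s where s: "s > 0" "cball z s \<subseteq> unit_disc"
    using z open_ball[of "0::complex" 1] open_contains_cball_eq by blast
  define B where "B u = cmod (m t u) / cmod (\<zeta> - \<phi> t u) + 1 / cmod (\<zeta> - u)" for u
  have nz: "\<zeta> - u \<noteq> 0" if "u \<in> unit_disc" for u using \<zeta> that by auto
  have "continuous_on (cball z s) (m t)" "continuous_on (cball z s) (\<phi> t)"
    using flow_holomorphic[OF t] cocycle_holomorphic[OF t] s(2)
    by (meson holomorphic_on_imp_continuous_on holomorphic_on_subset)+
  moreover have "cmod (\<zeta> - \<phi> t u) \<noteq> 0" "cmod (\<zeta> - u) \<noteq> 0" if "u \<in> cball z s" for u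
    using nz flow_in_disc[OF t] subsetD[OF s(2) that] by simp_all
  ultimately have "continuous_on (cball z s) B"
    unfolding B_def by (intro continuous_intros) blast+
  then have "bounded (B ` cball z s)"
    by (intro compact_imp_bounded compact_continuous_image) auto
  then obtain M where M: "M > 0" "\<And>u. u \<in> cball z s \<Longrightarrow> B u \<le> M"
    unfolding bounded_pos by (auto simp: abs_le_iff)
  define \<eta> where "\<eta> = \<delta> * s / M"
  have \<eta>: "\<eta> > 0" using \<open>\<delta> > 0\<close> s M by (simp add: \<eta>_def)
  have "defect t z h \<le> \<delta>"
    if h: "h \<in> Hol unit_disc" and le: "\<And>u. u \<in> unit_disc \<Longrightarrow> cmod (h u) \<le> \<eta> / cmod (\<zeta> - u)" for h
  proof -
    let ?D = "\<lambda>u. weighted_composition m \<phi> t h u - h u"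
    have hol: "?D holomorphic_on unit_disc"
      using weighted_composition_in_Hol[OF t h] h by (auto simp: Hol_def intro!: holomorphic_intros)
    have D: "cmod (?D u) \<le> \<eta> * M" if u: "u \<in> cball z s" for u
    proof -
      have ud: "u \<in> unit_disc" using u s by blast
      have "cmod (?D u) \<le> cmod (m t u) * cmod (h (\<phi> t u)) + cmod (h u)"
        using ud norm_triangle_ineq4[of "m t u * h (\<phi> t u)" "h u"]
        by (simp add: weighted_composition_def zero_ext_def norm_mult)
      also have "\<dots> \<le> cmod (m t u) * (\<eta> / cmod (\<zeta> - \<phi> t u)) + \<eta> / cmod (\<zeta> - u)"
        using ud by (intro add_mono mult_left_mono le flow_in_disc[OF t]) auto
      also have "\<dots> = \<eta> * B u" by (simp add: B_def algebra_simps)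
      also have "\<dots> \<le> \<eta> * M" using M(2)[OF u] \<eta> by (intro mult_left_mono) auto
      finally show ?thesis .
    qed
    show ?thesis
      using bloch_at_le_sup[OF hol s D] s M by (simp add: defect_def \<eta>_def)
  qed
  then show ?thesis using \<eta> by blast
qed

end

section \<open>Failure of strong continuity\<close>

theorem theorem4p1:
  fixes X :: "(complex \<Rightarrow> complex) set"
    and N :: "(complex \<Rightarrow> complex) \<Rightarrow> real"
    and \<phi> m :: "real \<Rightarrow> complex \<Rightarrow> complex"
  assumes "banach_analytic_space X N"
    and "H_infinity \<subseteq> X" and "X \<subseteq> Bloch"
    and "continuous_map Hol_closed_disc_topology (norm_topology X N) (\<lambda>f. f)"
    and "continuous_map (norm_topology X N) (Hol_topology unit_disc) (\<lambda>f. f)"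
    and "holomorphic_flow \<phi>" and "\<not> trivial_flow \<phi>"
    and "cocycle \<phi> m"
  shows "\<not> strongly_continuous_semigroup X N (weighted_composition m \<phi>)"
proof
  assume sc: "strongly_continuous_semigroup X N (weighted_composition m \<phi>)"
  interpret banach_analytic_space X N by fact
  interpret weighted_flow \<phi> m by unfold_locales fact+
  let ?W = "weighted_composition m \<phi>"
  have W_X: "?W t f \<in> X" if "t \<ge> 0" "f \<in> X" for t f
    using sc that unfolding strongly_continuous_semigroup_def bounded_linear_operator_on_def by blast
  have W_lim: "((\<lambda>t. N (\<lambda>u. ?W t f u - f u)) \<longlongrightarrow> 0) (at_right 0)" if "f \<in> X" for f
    using sc that unfolding strongly_continuous_semigroup_def by blast
  obtain C where C: "\<And>z f. z \<in> unit_disc \<Longrightarrow> f \<in> X \<Longrightarrow> bloch_at z f \<le> C * N f"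
    using Bloch_inclusion_bounded[OF assms(3,5)] by blast
  have defect_tendsto: "\<exists>\<eta>>0. \<forall>t z. 0 < t \<longrightarrow> t < \<eta> \<longrightarrow> z \<in> unit_disc \<longrightarrow> defect t z f \<le> 1 / 64"
    if f: "f \<in> X" for f
  proof -
    have "((\<lambda>t. C * N (\<lambda>u. ?W t f u - f u)) \<longlongrightarrow> C * 0) (at_right 0)"
      by (intro tendsto_mult tendsto_const W_lim f)
    then have "\<forall>\<^sub>F t in at_right 0. C * N (\<lambda>u. ?W t f u - f u) < 1 / 64"
      by (rule order_tendstoD) simp
    then obtain \<eta> where "\<eta> > 0"
      and \<eta>: "\<And>t. 0 < t \<Longrightarrow> t < \<eta> \<Longrightarrow> C * N (\<lambda>u. ?W t f u - f u) < 1 / 64"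
      unfolding eventually_at_right_field by blast
    have "defect t z f \<le> 1 / 64" if "0 < t" "t < \<eta>" "z \<in> unit_disc" for t z
    proof -
      have "(\<lambda>u. ?W t f u - f u) \<in> X" using that f by (intro diff W_X) auto
      then show ?thesis
        unfolding defect_def using C[OF that(3), of "\<lambda>u. ?W t f u - f u"] \<eta>[OF that(1,2)] by linarith
    qed
    then show ?thesis using \<open>\<eta> > 0\<close> by blast
  qed
  obtain \<zeta> where \<zeta>: "cmod \<zeta> = 1"
    and displaced: "\<And>\<eta>. \<eta> > 0 \<Longrightarrow> \<exists>t z. 0 < t \<and> t < \<eta> \<and> z \<in> unit_disc \<and> cmod (\<zeta> - z) < \<eta> \<and>
           1 / 2 < cmod (Moebius_function 0 (\<phi> t z) z)"
    using displaced_boundary_point[OF assms(6,7)] by blast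
  define H where "H t z = hump \<zeta> z (\<phi> t z)" for t z
  have H: "H t z \<in> H_infinity" "H t z \<in> Hol unit_disc" "H t z \<in> X"
    if "t \<ge> 0" "z \<in> unit_disc" for t z
    using hump_in_H_infinity[OF \<zeta> that(2) flow_in_disc[OF that]] assms(2)
    by (auto simp: H_def H_infinity_def)

  \<comment> \<open>A stage of the construction: the partial sum \<open>F\<close> of the humps chosen so far, the next time \<open>t\<close>
    and point \<open>z\<close>, and a tolerance \<open>\<eta>\<close> that every later choice must respect.\<close>
  define good where "good n F \<eta> t z \<longleftrightarrow> F \<in> X \<and> \<eta> > 0 \<and> 0 < t \<and> t < inverse (real (Suc n)) \<and>
      z \<in> unit_disc \<and> 1 / 2 < cmod (Moebius_function 0 (\<phi> t z) z) \<and> defect t z F \<le> 1 / 64 \<and>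
      (\<forall>h\<in>Hol unit_disc. (\<forall>u\<in>unit_disc. cmod (h u) \<le> \<eta> / cmod (\<zeta> - u)) \<longrightarrow> defect t z h \<le> 1 / 64)"
    for n F \<eta> t z
  have choose: "\<exists>\<eta> t z. good n F \<eta> t z \<and> cmod (\<zeta> - z) \<le> \<kappa>"
    if F: "F \<in> X" and "\<kappa> > 0" for n F and \<kappa> :: real
  proof -
    obtain \<eta>0 where \<eta>0: "\<eta>0 > 0"
        "\<And>t z. 0 < t \<Longrightarrow> t < \<eta>0 \<Longrightarrow> z \<in> unit_disc \<Longrightarrow> defect t z F \<le> 1 / 64"
      using defect_tendsto[OF F] by blast
    have "min (min \<eta>0 \<kappa>) (inverse (real (Suc n))) > 0" using \<eta>0 \<open>\<kappa> > 0\<close> by simp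
    from displaced[OF this] obtain t z where tz: "0 < t" "t < min (min \<eta>0 \<kappa>) (inverse (real (Suc n)))"
        "z \<in> unit_disc" "cmod (\<zeta> - z) < min (min \<eta>0 \<kappa>) (inverse (real (Suc n)))"
        "1 / 2 < cmod (Moebius_function 0 (\<phi> t z) z)"
      by blast
    obtain \<eta> where \<eta>: "\<eta> > 0" "\<forall>h\<in>Hol unit_disc.
        (\<forall>u\<in>unit_disc. cmod (h u) \<le> \<eta> / cmod (\<zeta> - u)) \<longrightarrow> defect t z h \<le> 1 / 64"
      using defect_small_if_dominated[OF less_imp_le[OF tz(1)] tz(3) \<zeta>, of "1 / 64"] by auto
    have "defect t z F \<le> 1 / 64" using \<eta>0(2) tz by simp
    then have "good n F \<eta> t z \<and> cmod (\<zeta> - z) \<le> \<kappa>"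
      unfolding good_def using F \<eta> tz by auto
    then show ?thesis by blast
  qed
  define admissible where "admissible = (\<lambda>n (F, \<eta>, t, z). good n F \<eta> t z \<and> (n = 0 \<longrightarrow> F = (\<lambda>u. 0)))"
  \<comment> \<open>The tail estimate for lacunary sums carries the factor \<open>8\<close>, hence the bound \<open>\<eta> / 8\<close> on the next scale.\<close>
  define successor where "successor = (\<lambda>(F, \<eta>, t, z) (F', \<eta>' :: real, t' :: real, z').
    F' = (\<lambda>u. F u + H t z u) \<and> cmod (\<zeta> - z') \<le> min (\<eta> / 8) (cmod (\<zeta> - z) / 2))"
  have "\<exists>s. \<forall>n. admissible n (s n) \<and> successor (s n) (s (Suc n))"
  proof (rule dependent_nat_choice, goal_cases)
    case 1
    obtain \<eta> t z where "good 0 (\<lambda>u. 0) \<eta> t z"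
      using choose[OF zero zero_less_one] by blast
    then show ?case by (intro exI[of _ "(\<lambda>u. 0, \<eta>, t, z)"]) (simp add: admissible_def)
  next
    case (2 x n)
    obtain F \<eta> t z where x: "x = (F, \<eta>, t, z)" by (cases x)
    with 2 have g: "good n F \<eta> t z" by (simp add: admissible_def)
    then have "(\<lambda>u. F u + H t z u) \<in> X" and "min (\<eta> / 8) (cmod (\<zeta> - z) / 2) > 0"
      using boundary_point_dist_pos[OF \<zeta>, of z] unfolding good_def by (auto intro!: add H)
    from choose[OF this] obtain \<eta>' t' z' where "good (Suc n) (\<lambda>u. F u + H t z u) \<eta>' t' z'"
        "cmod (\<zeta> - z') \<le> min (\<eta> / 8) (cmod (\<zeta> - z) / 2)"
      by blast
    then show ?case
      by (intro exI[of _ "(\<lambda>u. F u + H t z u, \<eta>', t', z')"]) (simp add: x admissible_def successor_def)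
  qed
  then obtain s where s: "\<And>n. admissible n (s n)" "\<And>n. successor (s n) (s (Suc n))"
    by blast
  define F where "F n = fst (s n)" for n
  define \<eta> where "\<eta> n = fst (snd (s n))" for n
  define t where "t n = fst (snd (snd (s n)))" for n
  define z where "z n = snd (snd (snd (s n)))" for n
  define f where "f n = H (t n) (z n)" for n
  define \<epsilon> where "\<epsilon> n = cmod (\<zeta> - z n)" for n
  have s_eq: "s n = (F n, \<eta> n, t n, z n)" for n
    by (simp add: F_def \<eta>_def t_def z_def)
  have good: "good n (F n) (\<eta> n) (t n) (z n)" for n
    using s(1)[of n] by (simp add: s_eq admissible_def)
  have F_0: "F 0 = (\<lambda>u. 0)"
    using s(1)[of 0] by (simp add: s_eq admissible_def)
  have F_Suc: "F (Suc n) = (\<lambda>u. F n u + f n u)" for n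
    using s(2)[of n] by (simp add: s_eq successor_def f_def)
  have \<epsilon>_step: "\<epsilon> (Suc n) \<le> \<eta> n / 8" "\<epsilon> (Suc n) \<le> \<epsilon> n / 2" for n
    using s(2)[of n] by (simp_all add: s_eq successor_def \<epsilon>_def)
  have F_sum: "F n u = (\<Sum>k<n. f k u)" for n u
    by (induction n) (simp_all add: F_0 F_Suc)
  have t: "0 < t n" "t n < inverse (real (Suc n))" and z: "z n \<in> unit_disc"
    and FX: "F n \<in> X" and far: "1 / 2 < cmod (Moebius_function 0 (\<phi> (t n) (z n)) (z n))"
    and early: "defect (t n) (z n) (F n) \<le> 1 / 64"
    and late: "\<And>h. h \<in> Hol unit_disc \<Longrightarrow>
      (\<And>u. u \<in> unit_disc \<Longrightarrow> cmod (h u) \<le> \<eta> n / cmod (\<zeta> - u)) \<Longrightarrow> defect (t n) (z n) h \<le> 1 / 64"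
    for n
    using good[of n] unfolding good_def by auto
  obtain G where G: "G \<in> H_infinity"
      "\<And>n u. u \<in> unit_disc \<Longrightarrow> cmod (G u - (\<Sum>k<n. f k u)) \<le> 8 * \<epsilon> n / cmod (\<zeta> - u)"
  proof (rule lacunary_sum[OF \<zeta>, of \<epsilon> f])
    show "\<epsilon> k > 0" for k using boundary_point_dist_pos[OF \<zeta> z] by (simp add: \<epsilon>_def)
    show "\<epsilon> (Suc k) \<le> \<epsilon> k / 2" for k by (rule \<epsilon>_step)
    show "f k \<in> Hol unit_disc" for k
      unfolding f_def by (rule H(2)[OF less_imp_le[OF t(1)] z])
    show "cmod (f k u) \<le> 4 * (\<epsilon> k * cmod (\<zeta> - u) / (\<epsilon> k + cmod (\<zeta> - u))\<^sup>2)"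
      if "u \<in> unit_disc" for k u
      unfolding f_def H_def
      by (rule norm_hump_le[OF \<zeta> z flow_in_disc[OF less_imp_le[OF t(1)] z] that \<epsilon>_def])
  qed blast
  have GX: "G \<in> X" using G(1) assms(2) by blast
  \<comment> \<open>Split \<open>G\<close> into the humps before \<open>n\<close>, the \<open>n\<close>th hump and the tail \<open>h\<close>: the defects of the first
    and last part are at most \<open>1/64\<close>, that of the hump is at least \<open>1/16\<close>.\<close>
  have large: "1 / 32 \<le> defect (t n) (z n) G" for n
  proof -
    note t0 = less_imp_le[OF t(1)[of n]]
    define h where "h u = G u - F (Suc n) u" for u
    have "h \<in> X" unfolding h_def[abs_def] by (intro diff GX FX)
    then have h: "h \<in> Hol unit_disc" using analytic by blast
    have G_minus: "(\<lambda>u. G u - F n u) \<in> Hol unit_disc"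
      using diff[OF GX FX] analytic by blast
    have small: "defect (t n) (z n) h \<le> 1 / 64"
    proof (rule late[OF h])
      fix u assume u: "u \<in> unit_disc"
      have "8 * \<epsilon> (Suc n) / cmod (\<zeta> - u) \<le> \<eta> n / cmod (\<zeta> - u)"
        using \<epsilon>_step(1)[of n] by (intro divide_right_mono) auto
      then show "cmod (h u) \<le> \<eta> n / cmod (\<zeta> - u)"
        using G(2)[OF u, of "Suc n"] by (simp only: h_def F_sum)
    qed
    have f_eq: "f n = (\<lambda>u. (G u - F n u) - h u)"
      by (simp add: h_def F_Suc)
    have "1 / 16 \<le> defect (t n) (z n) (f n)"
      unfolding f_def H_def by (rule defect_hump[OF t0 \<zeta> z far])
    also have "\<dots> \<le> defect (t n) (z n) (\<lambda>u. G u - F n u) + defect (t n) (z n) h"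
      unfolding f_eq by (rule defect_diff[OF t0 z G_minus h])
    also have "\<dots> \<le> (defect (t n) (z n) G + defect (t n) (z n) (F n)) + defect (t n) (z n) h"
      using GX FX[of n] analytic by (intro add_right_mono defect_diff[OF t0 z]) auto
    finally show ?thesis using early[of n] small by simp
  qed
  obtain \<eta>' where \<eta>': "\<eta>' > 0"
      "\<And>t z. 0 < t \<Longrightarrow> t < \<eta>' \<Longrightarrow> z \<in> unit_disc \<Longrightarrow> defect t z G \<le> 1 / 64"
    using defect_tendsto[OF GX] by blast
  obtain n where "inverse (real (Suc n)) < \<eta>'"
    using reals_Archimedean[OF \<eta>'(1)] by blast
  then have "defect (t n) (z n) G \<le> 1 / 64"
    using \<eta>'(2)[OF t(1) _ z] t(2)[of n] by simp
  then show False using large[of n] by simp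
qed

end
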